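(* Let $p$ be an odd prime, let $m$ be a positive integer, let $\mathrm{Tr}$ be the trace function from $\mathbb{F}_{p^m}$ to $\mathbb{F}_p$, and let $D=\{x\in\mathbb{F}_{p^m}^*:\mathrm{Tr}(x^2)=0\}=\{d_1,d_2,\dots,d_n\}$ (with $d_1,\dots,d_n$ distinct). Let $$C_D=\{(\mathrm{Tr}(ad_1),\mathrm{Tr}(ad_2),\dots,\mathrm{Tr}(ad_n)):a\in\mathbb{F}_{p^m}\}.$$ (A) If $m\geqslant 3$ is odd, then $C_D$ is a $[p^{m-1}-1,\,m]$ linear code over $\mathbb{F}_p$ with complete weight enumerator \begin{align*} \mathrm{CWE}(C_D)={}&w_0^{p^{m-1}-1}+(p^{m-1}-1)\,w_0^{p^{m-2}-1}\prod_{\rho=1}^{p-1}w_\rho^{p^{m-2}}\\ &+\frac{p-1}{2}\left(p^{m-1}+p^{\frac{m-1}{2}}\right)w_0^{p^{m-2}-1+(p-1)p^{\frac{m-3}{2}}}\prod_{\rho=1}^{p-1}w_\rho^{p^{m-2}-p^{\frac{m-3}{2}}}\\ &+\frac{p-1}{2}\left(p^{m-1}-p^{\frac{m-1}{2}}\right)w_0^{p^{m-2}-1-(p-1)p^{\frac{m-3}{2}}}\prod_{\rho=1}^{p-1}w_\rho^{p^{m-2}+p^{\frac{m-3}{2}}}. \end{align*} (B) If $m\geqslant 2$ is even, then, writing $\varepsilon=(-1)^{\frac{m}{2}\left(\frac{p-1}{2}\right)^2}$, the code $C_D$ over $\mathbb{F}_p$ has parameters $$\left[\,p^{m-1}-1-\varepsilon(p-1)p^{\frac{m-2}{2}},\;m\,\right]$$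 and complete weight enumerator \begin{align*} \mathrm{CWE}(C_D)={}&w_0^{p^{m-1}-1-\varepsilon(p-1)p^{\frac{m-2}{2}}}\\ &+\left(p^{m-1}-1-\varepsilon(p-1)p^{\frac{m-2}{2}}\right)w_0^{p^{m-2}-1-\varepsilon(p-1)p^{\frac{m-2}{2}}}\prod_{\rho=1}^{p-1}w_\rho^{p^{m-2}}\\ &+(p-1)\left(p^{m-1}+\varepsilon p^{\frac{m-2}{2}}\right)w_0^{p^{m-2}-1}\prod_{\rho=1}^{p-1}w_\rho^{p^{m-2}-\varepsilon p^{\frac{m-2}{2}}}. \end{align*}
   Context: An $[n,\kappa]$ linear code over $\mathbb{F}_p$ is a $\kappa$-dimensional $\mathbb{F}_p$-subspace of $\mathbb{F}_p^n$. Complete weight enumerator: attach to the elements $0,1,\dots,p-1$ of $\mathbb{F}_p$ formal commuting variables $w_0,w_1,\dots,w_{p-1}$. For $\mathsf{c}=(c_0,\dots,c_{n-1})\in\mathbb{F}_p^n$ put $w[\mathsf{c}]=w_0^{k_0}w_1^{k_1}\cdots w_{p-1}^{k_{p-1}}$, where $k_j$ is the number of coordinates of $\mathsf{c}$ equal to $j$ (so $\sum_j k_j=n$). The complete weight enumerator of a code $C\subseteq\mathbb{F}_p^n$ is $\mathrm{CWE}(C)=\sum_{\mathsf{c}\in C}w[\mathsf{c}]$.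
   Formalization: In (B) the dimension and the complete weight enumerator are asserted only when D is nonempty; this excludes exactly m = 2 with p ≡ 1 (mod 4), where n = 0, C_D is the zero code and the printed claim fails. The length formula is kept for all even m ≥ 2. *)

theory Defs
  imports
    "HOL-Library.Poly_Mapping"
    "Berlekamp_Zassenhaus.Finite_Field"
    "Jordan_Normal_Form.VS_Connect"
begin

text \<open>
  \<open>'p mod_ring\<close> with \<open>'p :: prime_card\<close> is the prime field on \<open>{0, \<dots>, p - 1}\<close>, \<open>p = CARD('p)\<close>.
  Its extension of degree \<open>m\<close> is any finite field type \<open>'a\<close> with \<open>CARD('a) = p ^ m\<close>; then \<open>'a\<close> has
  characteristic \<open>p\<close>, and \<open>\<lambda>t. of_int (to_int_mod_ring t)\<close> embeds \<open>'p mod_ring\<close> in \<open>'a\<close>.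
  The sum of the conjugates \<open>x ^ p ^ i\<close> with \<open>i < m\<close> is fixed by \<open>y \<mapsto> y ^ p\<close>, hence it is the image
  of exactly one element of \<open>'p mod_ring\<close>.
\<close>

definition field_trace :: "nat \<Rightarrow> 'a::{field,finite} \<Rightarrow> 'p::prime_card mod_ring" where
  "field_trace m x =
     (THE t. of_int (to_int_mod_ring t) = (\<Sum>i<m. x ^ (CARD('p) ^ i)))"

definition linear_code :: "nat \<Rightarrow> nat \<Rightarrow> 'k::field vec set \<Rightarrow> bool" where
  "linear_code n k C \<longleftrightarrow>
     subspace class_ring C (module_vec TYPE('k) n) \<and>
     vectorspace.dim class_ring (module_vec TYPE('k) n \<lparr>carrier := C\<rparr>) = k"

text \<open>
  A polynomial in the variables \<open>w\<^sub>0, w\<^sub>1, \<dots>\<close> maps exponent vectors \<open>nat \<Rightarrow>\<^sub>0 nat\<close> to integer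
  coefficients; multiplication on \<open>poly_mapping\<close> is convolution.
\<close>

type_synonym int_mpoly = "(nat \<Rightarrow>\<^sub>0 nat) \<Rightarrow>\<^sub>0 int"

definition W :: "nat \<Rightarrow> int_mpoly" where
  "W j = Poly_Mapping.single (Poly_Mapping.single j 1) 1"

definition weight_monomial :: "'p::prime_card mod_ring vec \<Rightarrow> int_mpoly" where
  "weight_monomial c =
     (\<Prod>j<CARD('p). W j ^ card {i. i < dim_vec c \<and> c $ i = of_nat j})"

definition CWE :: "'p::prime_card mod_ring vec set \<Rightarrow> int_mpoly" where
  "CWE C = (\<Sum>c\<in>C. weight_monomial c)"

end

theory Submission
  imports Defs
begin

text \<open>
  Everything reduces to counting, for \<open>a \<noteq> 0\<close>, the \<open>x\<close> with \<open>Tr (x\<^sup>2) = 0\<close> and \<open>Tr (a x) = \<rho>\<close>; no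
  character sums are needed. If \<open>Tr (a\<^sup>2) = 0\<close> and \<open>\<rho> \<noteq> 0\<close>, translation by multiples of \<open>a\<close> gives the
  count \<open>p ^ (m - 2)\<close>. If \<open>Tr (a\<^sup>2) = v \<noteq> 0\<close>, reflections show that the count depends on \<open>v\<close> only, and
  counting the pairs \<open>(a, x)\<close> in two ways expresses it by the numbers \<open>N v\<close> of solutions of
  \<open>Tr (x\<^sup>2) = v\<close>.

  For odd \<open>m\<close>, a nonsquare \<open>g\<close> of the prime field stays a nonsquare, so \<open>N v + N (v / g) = 2 p ^ (m - 1)\<close>;
  the second moment of \<open>N\<close> gives the deviation from the mean up to a sign, and the two signs occur
  equally often. For even \<open>m\<close>, all scalars are squares, so \<open>N\<close> is constant on \<open>v \<noteq> 0\<close>, and \<open>N 0\<close> follows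
  by averaging \<open>Tr (t x\<^sup>2) = 0\<close> over the subfield \<open>K\<close> of order \<open>Q = p ^ (m / 2)\<close>: the functional
  \<open>t \<mapsto> Tr (t x\<^sup>2)\<close> vanishes on \<open>K\<close> iff \<open>x ^ (2 (Q - 1)) = -1\<close>, which is solvable iff
  \<open>Q \<equiv> 3 (mod 4)\<close>. This is the source of the sign \<open>\<epsilon>\<close>.
\<close>

section \<open>Finite fields\<close>

lemma card_eq_sum_fibres:
  fixes f :: "'b \<Rightarrow> 'c::finite"
  assumes "finite A"
  shows "card A = (\<Sum>c\<in>UNIV. card {x\<in>A. f x = c})"
  using sum.group[of A UNIV f "\<lambda>_. 1::nat"] assms by simp

lemma card_finite_field_gt_1: "CARD('a::{field,finite}) > 1"
proof -
  have "card {0, 1::'a} \<le> CARD('a)"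
    by (rule card_mono) simp_all
  then show ?thesis by simp
qed

section \<open>Fermat's theorem and roots of unity\<close>

lemma finite_field_power_card_minus_1:
  fixes x :: "'a::{field,finite}"
  assumes "x \<noteq> 0"
  shows "x ^ (CARD('a) - 1) = 1"
proof -
  have "x ^ (CARD('a) - 1) * \<Prod>(UNIV - {0::'a}) = (\<Prod>y\<in>UNIV - {0}. x * y)"
    by (simp add: prod.distrib)
  also have "\<dots> = \<Prod>(UNIV - {0::'a})"
    by (rule prod.reindex_bij_witness[of _ "\<lambda>y. y / x" "\<lambda>y. x * y"]) (use assms in auto)
  finally show ?thesis
    by (metis DiffE finite insertI1 mult_cancel_right1 prod_zero_iff)
qed

lemma finite_field_power_card: "(x::'a::{field,finite}) ^ CARD('a) = x"
proof (cases "x = 0")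
  case False
  have "x ^ CARD('a) = x * x ^ (CARD('a) - 1)"
    by (metis power_minus_mult mult.commute zero_less_card_finite)
  then show ?thesis
    by (simp only: finite_field_power_card_minus_1[OF False] mult_1_right)
qed simp

text \<open>With q = \<open>CARD('a)\<close>, the polynomial \<open>?f\<close> has at most
  \<open>d\<close> roots and its cofactor \<open>?g\<close> in x^(q-1) - 1 at most q - 1 -
  \<open>d\<close>. Together they must account for all q - 1 nonzero elements, so the first bound is
  attained.\<close>

lemma card_roots_of_unity:
  assumes d: "d dvd CARD('a::{field,finite}) - 1" and "d > 0"
  shows "card {x::'a. x ^ d = 1} = d"
proof (rule antisym)
  obtain e where e: "CARD('a) - 1 = d * e"
    using d by (elim dvdE)
  then have "e > 0"
    using card_finite_field_gt_1[where 'a = 'a] by (intro gr0I) auto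
  let ?f = "monom 1 d - 1 :: 'a poly" and ?g = "\<Sum>i<e. monom 1 (d * i) :: 'a poly"
  have "coeff ?f d = 1"
    using \<open>d > 0\<close> by simp
  then have "?f \<noteq> 0"
    by (metis coeff_0 zero_neq_one)
  then have "card {x. poly ?f x = 0} \<le> degree ?f"
    by (rule card_poly_roots_bound)
  also have "\<dots> \<le> d"
    by (rule degree_diff_le) (simp_all add: degree_monom_le)
  finally show "card {x::'a. x ^ d = 1} \<le> d"
    by (simp add: poly_monom)
  have "poly ?g 0 = (\<Sum>i<e. if i = 0 then 1 else 0)"
    using \<open>d > 0\<close> by (simp add: poly_sum poly_monom power_0_left)
  then have "poly ?g 0 = 1"
    using \<open>e > 0\<close> by simp
  then have "?g \<noteq> 0"
    by (metis poly_0 zero_neq_one)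
  then have "card {x. poly ?g x = 0} \<le> degree ?g"
    by (rule card_poly_roots_bound)
  also have "\<dots> \<le> d * (e - 1)"
    by (rule degree_sum_le) (auto intro!: order.trans[OF degree_monom_le])
  finally have g: "card {x. poly ?g x = 0} \<le> d * (e - 1)" .
  have "poly ?g x = 0" if "x \<noteq> 0" "x ^ d \<noteq> 1" for x
  proof -
    have "(x ^ d - 1) * (\<Sum>i<e. (x ^ d) ^ i) = (x ^ d) ^ e - 1"
      by (simp add: power_diff_1_eq)
    also have "\<dots> = 0"
      using finite_field_power_card_minus_1[OF that(1)] e by (simp add: power_mult)
    finally show ?thesis
      using that(2) by (simp add: poly_sum poly_monom power_mult)
  qed
  then have "UNIV - {0} \<subseteq> {x. x ^ d = 1} \<union> {x. poly ?g x = 0}"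
    by auto
  then have "card (UNIV - {0::'a}) \<le> card ({x. x ^ d = 1} \<union> {x. poly ?g x = 0})"
    by (intro card_mono) simp_all
  also have "\<dots> \<le> card {x::'a. x ^ d = 1} + card {x. poly ?g x = 0}"
    by (rule card_Un_le)
  finally have "d * e \<le> card {x::'a. x ^ d = 1} + d * (e - 1)"
    using g e by simp
  moreover have "d * e = d * (e - 1) + d"
    using \<open>e > 0\<close> by (cases e) simp_all
  ultimately show "d \<le> card {x::'a. x ^ d = 1}"
    by simp
qed

section \<open>Squares and Euler's criterion\<close>

lemma card_square_roots:
  fixes y :: "'a::{field,finite}"
  assumes "(2::'a) \<noteq> 0" and "y \<noteq> 0"
  shows "card {x. x\<^sup>2 = y} = (if \<exists>x. y = x\<^sup>2 then 2 else 0)"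
proof (cases "\<exists>x. y = x\<^sup>2")
  case True
  then obtain c where c: "y = c\<^sup>2" by blast
  have "c \<noteq> - c"
    using assms c by (auto simp: eq_neg_iff_add_eq_0 simp flip: mult_2)
  moreover have "{x. x\<^sup>2 = y} = {c, - c}"
    by (auto simp: c power2_eq_iff)
  ultimately show ?thesis
    using True by simp
qed auto

lemma card_nonzero_squares:
  assumes "(2::'a::{field,finite}) \<noteq> 0"
  shows "2 * card {y::'a. y \<noteq> 0 \<and> (\<exists>x. y = x\<^sup>2)} = CARD('a) - 1"
proof -
  have "CARD('a) - 1 = card (UNIV - {0::'a})"
    by simp
  also have "\<dots> = (\<Sum>y\<in>UNIV. card {x\<in>UNIV - {0::'a}. x\<^sup>2 = y})"
    by (rule card_eq_sum_fibres) simp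
  also have "\<dots> = (\<Sum>y\<in>(UNIV::'a set). if y \<noteq> 0 \<and> (\<exists>x. y = x\<^sup>2) then 2 else 0)"
  proof (rule sum.cong[OF refl])
    fix y :: 'a
    show "card {x\<in>UNIV - {0::'a}. x\<^sup>2 = y} = (if y \<noteq> 0 \<and> (\<exists>x. y = x\<^sup>2) then 2 else 0)"
    proof (cases "y = 0")
      case False
      then have "{x\<in>UNIV - {0::'a}. x\<^sup>2 = y} = {x. x\<^sup>2 = y}"
        by auto
      then show ?thesis
        using card_square_roots[OF assms False] False by simp
    qed auto
  qed
  also have "\<dots> = 2 * card {y::'a. y \<noteq> 0 \<and> (\<exists>x. y = x\<^sup>2)}"
    by (simp flip: sum.inter_filter)
  finally show ?thesis by simp
qed

text \<open>Euler's criterion: nonzero squares satisfy the power equation, and both sets have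
  \<open>?h\<close> elements.\<close>

lemma square_iff_power_eq_1:
  fixes x :: "'a::{field,finite}"
  assumes "(2::'a) \<noteq> 0" and "x \<noteq> 0"
  shows "(\<exists>y. x = y\<^sup>2) \<longleftrightarrow> x ^ ((CARD('a) - 1) div 2) = 1"
proof -
  let ?h = "(CARD('a) - 1) div 2"
  have "2 dvd CARD('a) - 1"
    unfolding card_nonzero_squares[OF assms(1), symmetric] by (rule dvd_triv_left)
  then have h: "CARD('a) - 1 = 2 * ?h"
    by (rule dvd_mult_div_cancel[symmetric])
  then have "?h > 0"
    using card_finite_field_gt_1[where 'a = 'a] by (intro gr0I) simp
  let ?S = "{y::'a. y \<noteq> 0 \<and> (\<exists>x. y = x\<^sup>2)}" and ?U = "{y::'a. y ^ ?h = 1}"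
  have "?S = ?U"
  proof (rule card_subset_eq)
    show "?S \<subseteq> ?U"
      using finite_field_power_card_minus_1[where 'a = 'a] h by (auto simp flip: power_mult)
    show "card ?S = card ?U"
    proof -
      have "?h dvd CARD('a) - 1"
        by (subst h) simp
      then have "card ?U = ?h"
        using \<open>?h > 0\<close> by (rule card_roots_of_unity)
      moreover have "2 * card ?S = 2 * ?h"
        using card_nonzero_squares[OF assms(1)] h by simp
      ultimately show ?thesis by simp
    qed
  qed simp
  then show ?thesis
    using assms(2) by blast
qed

text \<open>By Euler's criterion both factors have \<open>?h\<close>-th power -1, so their product
  has \<open>?h\<close>-th power 1.\<close>

lemma nonsquare_mult:
  fixes x y :: "'a::{field,finite}"
  assumes two: "(2::'a) \<noteq> 0" and "\<nexists>z. x = z\<^sup>2" and "\<nexists>z. y = z\<^sup>2"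
  shows "\<exists>z. x * y = z\<^sup>2"
proof -
  let ?h = "(CARD('a) - 1) div 2"
  have "2 dvd CARD('a) - 1"
    unfolding card_nonzero_squares[OF two, symmetric] by (rule dvd_triv_left)
  then have h: "CARD('a) - 1 = ?h * 2"
    by (rule dvd_div_mult_self[symmetric])
  have minus: "z \<noteq> 0 \<and> z ^ ?h = - 1" if "\<nexists>w. z = w\<^sup>2" for z :: 'a
  proof -
    have z: "z \<noteq> 0"
      using that by (metis power_zero_numeral)
    then have "(z ^ ?h)\<^sup>2 = 1"
      using finite_field_power_card_minus_1[OF z] h by (metis power_mult)
    then show ?thesis
      using z that square_iff_power_eq_1[OF two z] by (auto simp: power2_eq_1_iff)
  qed
  have "(x * y) ^ ?h = 1"
    using minus[OF assms(2)] minus[OF assms(3)] by (simp add: power_mult_distrib)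
  then show ?thesis
    using square_iff_power_eq_1[OF two, of "x * y"] minus[OF assms(2)] minus[OF assms(3)] by simp
qed

section \<open>Subfields and roots of -1\<close>

lemma diff_1_dvd_power_diff_1: "Q - 1 dvd Q ^ n - (1::nat)"
proof (induction n)
  case (Suc n)
  have "Q ^ Suc n - 1 = Q * (Q ^ n - 1) + (Q - 1)"
    by (cases "Q = 0") (simp_all add: diff_mult_distrib2)
  then show ?case
    using Suc by simp
qed simp

text \<open>Besides 0, the solutions are the roots of unity for the exponent \<open>Q - 1\<close>,
  which divides \<open>Q ^ n - 1\<close>. This serves for the prime field and for the subfield of
  order p^(m/2).\<close>

lemma card_power_eq_self:
  assumes "CARD('a::{field,finite}) = Q ^ n"
  shows "card {x::'a. x ^ Q = x} = Q"
proof -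
  have "2 \<le> Q ^ n"
    using card_finite_field_gt_1[where 'a = 'a] by (simp add: assms)
  then have Q: "Q > 1"
    by (cases Q; cases "Q = 1") (auto simp: power_0_left split: if_splits)
  then have pow: "x ^ Q = x * x ^ (Q - 1)" for x :: 'a
    by (cases Q) simp_all
  then have "{x::'a. x ^ Q = x} = insert 0 {x. x ^ (Q - 1) = 1}"
    using Q by (auto simp: pow)
  moreover have "card {x::'a. x ^ (Q - 1) = 1} = Q - 1"
    by (rule card_roots_of_unity) (use Q diff_1_dvd_power_diff_1[of Q n] in \<open>simp_all add: assms\<close>)
  moreover have "0 \<notin> {x::'a. x ^ (Q - 1) = 1}"
    using Q by (simp add: power_0_left)
  ultimately show ?thesis
    using Q by (simp only: card_insert_disjoint finite) simp
qed

text \<open>For \<open>t \<noteq> 0\<close> one has \<open>t ^ (Q - 1) = 1\<close>, and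
  \<open>Q - 1\<close> divides \<open>(Q\<^sup>2 - 1) div 2\<close> because \<open>Q + 1\<close> is
  even; Euler's criterion applies.\<close>

lemma square_of_power_eq_self:
  fixes t :: "'a::{field,finite}"
  assumes "(2::'a) \<noteq> 0" and "CARD('a) = Q\<^sup>2" and "odd Q" and "t ^ Q = t"
  shows "\<exists>u. t = u\<^sup>2"
proof (cases "t = 0")
  case False
  obtain k where k: "Q = 2 * k + 1"
    using \<open>odd Q\<close> by (elim oddE)
  have "t * t ^ (2 * k) = t * 1"
    using assms(4) by (simp add: k)
  then have "t ^ (2 * k) = 1"
    using False by (metis mult_left_cancel)
  moreover have "(Q\<^sup>2 - 1) div 2 = (2 * k) * (k + 1)"
    by (simp add: k power2_eq_square algebra_simps)
  ultimately have "t ^ ((CARD('a) - 1) div 2) = 1"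
    by (simp only: assms(2) power_mult power_one)
  then show ?thesis
    using square_iff_power_eq_1[OF assms(1) False] by blast
qed (metis power_zero_numeral)

text \<open>If 4 divides \<open>Q + 1\<close>, then \<open>4 * (Q - 1)\<close> divides
  \<open>Q\<^sup>2 - 1\<close>, and the solutions are the roots of unity for the exponent
  \<open>4 * (Q - 1)\<close> that are not roots for half of it. Otherwise
  \<open>Q\<^sup>2 - 1\<close> is an odd multiple of \<open>2 * (Q - 1)\<close>, and a solution
  would give 1 = -1.\<close>

lemma card_power_eq_minus_1:
  assumes "(2::'a::{field,finite}) \<noteq> 0" and "CARD('a) = Q\<^sup>2" and "odd Q" and "Q > 1"
  shows "card {x::'a. x ^ (2 * (Q - 1)) = - 1} = (if Q mod 4 = 3 then 2 * (Q - 1) else 0)"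
proof (cases "Q mod 4 = 3")
  case True
  have fac: "Q\<^sup>2 - 1 = (Q - 1) * (Q + 1)"
    using assms(4) by (cases Q) (simp_all add: power2_eq_square)
  have "4 dvd Q + 1"
    using True by presburger
  then have "4 * (Q - 1) dvd CARD('a) - 1"
    unfolding assms(2) fac by (subst mult.commute) (rule mult_dvd_mono, simp_all)
  then have "2 * (2 * (Q - 1)) dvd CARD('a) - 1" and "2 * (Q - 1) dvd CARD('a) - 1"
    by (simp_all, metis dvd_mult_right mult.assoc mult_2 numeral_Bit0)
  then have cards: "card {x::'a. x ^ (2 * (2 * (Q - 1))) = 1} = 2 * (2 * (Q - 1))"
      "card {x::'a. x ^ (2 * (Q - 1)) = 1} = 2 * (Q - 1)"
    using assms(4) by (simp_all only: card_roots_of_unity)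
  have sq: "x ^ (2 * (2 * (Q - 1))) = (x ^ (2 * (Q - 1)))\<^sup>2" for x :: 'a
    by (metis mult.commute power_mult)
  have "(1::'a) \<noteq> - 1"
    using assms(1) by (simp add: eq_neg_iff_add_eq_0)
  then have "{x::'a. x ^ (2 * (Q - 1)) = - 1}
      = {x. x ^ (2 * (2 * (Q - 1))) = 1} - {x. x ^ (2 * (Q - 1)) = 1}"
    unfolding sq power2_eq_1_iff by auto
  moreover have "{x::'a. x ^ (2 * (Q - 1)) = 1} \<subseteq> {x. x ^ (2 * (2 * (Q - 1))) = 1}"
    unfolding sq by auto
  ultimately show ?thesis
    using True by (simp only: card_Diff_subset cards finite) simp
next
  case False
  have "x ^ (2 * (Q - 1)) \<noteq> - 1" for x :: 'a
  proof
    assume x: "x ^ (2 * (Q - 1)) = - 1"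
    have "Q mod 4 = 1"
      using False \<open>odd Q\<close> by presburger
    then obtain k where k: "Q = 4 * k + 1"
      by (metis mult_div_mod_eq)
    have "x \<noteq> 0"
      using x assms(4) by (auto simp: power_0_left)
    then have "1 = x ^ (Q\<^sup>2 - 1)"
      using finite_field_power_card_minus_1[of x] assms(2) by simp
    also have "Q\<^sup>2 - 1 = (2 * (Q - 1)) * (2 * k + 1)"
      by (simp add: k power2_eq_square algebra_simps)
    also have "x ^ \<dots> = - 1"
      by (subst power_mult, subst x) simp
    finally show False
      using assms(1) by (simp add: eq_neg_iff_add_eq_0)
  qed
  then show ?thesis
    using False by simp
qed

section \<open>The quadratic form \<open>T (x\<^sup>2)\<close>\<close>

locale field_embedding =
  fixes emb :: "'k::{field,finite} \<Rightarrow> 'a::{field,finite}"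
  assumes emb_add: "emb (c + d) = emb c + emb d"
    and emb_mult: "emb (c * d) = emb c * emb d"
    and emb_1: "emb 1 = 1"
begin

lemma emb_0: "emb 0 = 0"
  by (metis add_cancel_right_left emb_add)

lemma emb_nonzero: "c \<noteq> 0 \<Longrightarrow> emb c \<noteq> 0"
  by (metis emb_1 emb_mult left_inverse mult_zero_right one_neq_zero)

lemma emb_minus: "emb (- c) = - emb c"
  by (metis add.right_inverse add_eq_0_iff emb_0 emb_add)

lemma emb_diff: "emb (c - d) = emb c - emb d"
  using emb_add[of c "- d"] emb_minus by simp

lemma emb_inj: "inj emb"
  using emb_diff emb_nonzero by (intro injI) (metis eq_iff_diff_eq_0)

lemma emb_power: "emb (c ^ i) = emb c ^ i"
  by (induction i) (simp_all add: emb_1 emb_mult)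

end

locale quadratic_trace = field_embedding emb
  for emb :: "'k::{field,finite} \<Rightarrow> 'a::{field,finite}" +
  fixes T :: "'a \<Rightarrow> 'k"
  assumes T_add: "T (x + y) = T x + T y"
    and T_smult: "T (emb c * x) = c * T x"
    and T_nonzero: "\<exists>x. T x \<noteq> 0"
    and two_nonzero: "(2::'k) \<noteq> 0"
begin

lemma card_k_gt_1: "CARD('k) > 1"
  by (rule card_finite_field_gt_1)

lemma two_nonzero': "(2::'a) \<noteq> 0"
  using emb_nonzero[OF two_nonzero] emb_add[of 1 1] by (simp add: emb_1)

lemma T_0: "T 0 = 0"
  by (metis add_cancel_right_left T_add)

lemma T_minus: "T (- x) = - T x"
  by (metis add.right_inverse add_eq_0_iff T_0 T_add)

lemma T_diff: "T (x - y) = T x - T y"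
  using T_add[of x "- y"] T_minus by simp

text \<open>The fibres of \<open>t \<mapsto> T (t * y)\<close> on \<open>V\<close> are translates of
  each other by multiples of \<open>e\<close>. \<open>V\<close> is kept general because both the
  whole field and the subfield \<open>K\<close> are needed.\<close>

lemma card_hyperplane:
  assumes add: "\<And>s t. s \<in> V \<Longrightarrow> t \<in> V \<Longrightarrow> s + t \<in> V"
    and smult: "\<And>c t. t \<in> V \<Longrightarrow> emb c * t \<in> V"
    and e: "e \<in> V" "T (e * y) \<noteq> 0"
  shows "CARD('k) * card {t\<in>V. T (t * y) = \<rho>} = card V"
proof -
  have fibre: "card {t\<in>V. T (t * y) = c} = card {t\<in>V. T (t * y) = \<rho>}" for c
  proof -
    define u where "u d = emb (d / T (e * y)) * e" for d
    have u: "u d \<in> V" "T (u d * y) = d" for d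
      using e smult by (simp_all add: u_def T_smult mult.assoc)
    show ?thesis
      by (rule bij_betw_same_card[of "\<lambda>t. t + u (\<rho> - c)"],
          rule bij_betw_byWitness[where f' = "\<lambda>t. t + u (c - \<rho>)"])
        (auto simp: u add T_add distrib_right, simp_all add: u_def emb_diff diff_divide_distrib algebra_simps)
  qed
  have "card V = (\<Sum>c\<in>UNIV. card {t\<in>V. T (t * y) = c})"
    by (rule card_eq_sum_fibres) simp
  also have "\<dots> = (\<Sum>c\<in>(UNIV :: 'k set). card {t\<in>V. T (t * y) = \<rho>})"
    by (intro sum.cong refl fibre)
  finally show ?thesis by simp
qed

lemma T_mult_nonzero: "a \<noteq> 0 \<Longrightarrow> \<exists>x. T (x * a) \<noteq> 0"
  using T_nonzero by (metis nonzero_divide_eq_eq)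

lemma card_T_mult_eq:
  assumes "a \<noteq> 0"
  shows "CARD('k) * card {x. T (a * x) = \<rho>} = CARD('a)"
  using T_mult_nonzero[OF assms] card_hyperplane[of UNIV _ a \<rho>]
  by (auto simp: mult.commute)

section \<open>Counting functions and isotropic vectors\<close>

definition N :: "'k \<Rightarrow> nat" where
  "N v = card {x. T (x\<^sup>2) = v}"

text \<open>The code needs only \<open>v = 0\<close>; other \<open>v\<close> occur in
  \<open>N_mult_M\<close>, where \<open>a\<close> and \<open>x\<close> change roles.\<close>

definition M :: "'k \<Rightarrow> 'a \<Rightarrow> 'k \<Rightarrow> nat" where
  "M v a \<rho> = card {x. T (x\<^sup>2) = v \<and> T (a * x) = \<rho>}"

lemma T_square_add:
  "T ((x + emb s * a)\<^sup>2) = T (x\<^sup>2) + 2 * s * T (a * x) + s\<^sup>2 * T (a\<^sup>2)"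
proof -
  have "(x + emb s * a)\<^sup>2 = x\<^sup>2 + emb (2 * s) * (a * x) + emb (s\<^sup>2) * a\<^sup>2"
    by (simp only: mult_2 emb_add emb_mult power2_eq_square) (simp add: algebra_simps)
  then show ?thesis
    by (simp add: T_add T_smult)
qed

lemma T_square_smult: "T ((emb c * x)\<^sup>2) = c\<^sup>2 * T (x\<^sup>2)"
  by (metis T_smult emb_power power_mult_distrib)

text \<open>Translating by multiples of an isotropic \<open>a\<close> changes \<open>T (x\<^sup>2)\<close> linearly and keeps
  \<open>T (a * x)\<close>, so every value of \<open>T (x\<^sup>2)\<close> is taken once along each line.\<close>

lemma M_isotropic:
  assumes "T (a\<^sup>2) = 0" and "\<rho> \<noteq> 0"
  shows "CARD('k) * M v a \<rho> = card {x. T (a * x) = \<rho>}"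
proof -
  have a2: "T (a * (emb s * a)) = 0" for s
    using assms(1) by (metis T_smult mult.left_commute mult_zero_right power2_eq_square)
  have shift: "x + emb s * a + emb t * a = x + emb (s + t) * a" for x s t
    by (simp add: emb_add algebra_simps)
  \<comment> \<open>Moving \<open>z\<close> by \<open>- s z\<close> along \<open>a\<close> changes
    \<open>T (z\<^sup>2)\<close> by \<open>- 2 * s z * \<rho>\<close>; solving for the value
    \<open>v\<close> gives this parameter.\<close>
  define s where "s z = (T (z\<^sup>2) - v) / (2 * \<rho>)" for z
  have s: "2 * s z * \<rho> = T (z\<^sup>2) - v" for z
    using assms(2) two_nonzero by (simp add: s_def)
  then have s_eq: "s z = c \<longleftrightarrow> T (z\<^sup>2) = v + 2 * c * \<rho>" for z c
    using assms(2) two_nonzero by (metis add.commute add_diff_cancel_right' diff_add_cancel mult_cancel_left mult_cancel_right)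
  have "bij_betw (\<lambda>(t, x). x + emb t * a)
      (UNIV \<times> {x. T (x\<^sup>2) = v \<and> T (a * x) = \<rho>}) {x. T (a * x) = \<rho>}"
  proof (rule bij_betw_byWitness[where f' = "\<lambda>z. (s z, z + emb (- s z) * a)"])
    have "s (x + emb t * a) = t" if "T (x\<^sup>2) = v" "T (a * x) = \<rho>" for x t
      using that by (simp add: s_eq T_square_add assms(1))
    then show "\<forall>z\<in>UNIV \<times> {x. T (x\<^sup>2) = v \<and> T (a * x) = \<rho>}.
        (\<lambda>z. (s z, z + emb (- s z) * a)) (case z of (t, x) \<Rightarrow> x + emb t * a) = z"
      by (auto simp: shift emb_0)
    have "T ((x + emb (- s x) * a)\<^sup>2) = v" if "T (a * x) = \<rho>" for x
      using s[of x] that by (simp only: T_square_add assms(1)) (simp add: algebra_simps)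
    then show "(\<lambda>z. (s z, z + emb (- s z) * a)) ` {x. T (a * x) = \<rho>}
        \<subseteq> UNIV \<times> {x. T (x\<^sup>2) = v \<and> T (a * x) = \<rho>}"
      by (auto simp only: distrib_left[of a] T_add a2) auto
  qed (auto simp: shift emb_0 distrib_left[of a] T_add a2)
  then show ?thesis
    using bij_betw_same_card by (force simp: M_def card_cartesian_product dest: bij_betw_same_card)
qed

section \<open>Reflections and the invariance of \<open>M\<close>\<close>

definition reflection :: "'a \<Rightarrow> 'a \<Rightarrow> 'a" where
  "reflection w x = x - emb (2 * T (w * x) / T (w\<^sup>2)) * w"

text \<open>For anisotropic \<open>w\<close>, \<open>reflection w\<close> is the orthogonal
  reflection sending \<open>w\<close> to \<open>- w\<close>, with respect to the symmetric bilinear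
  form \<open>T (x * y)\<close>; hence it is an isometry.\<close>

lemma T_reflection_mult:
  assumes "T (w\<^sup>2) \<noteq> 0"
  shows "T (reflection w x * reflection w y) = T (x * y)"
proof -
  let ?c = "2 * T (w * x) / T (w\<^sup>2)" and ?d = "2 * T (w * y) / T (w\<^sup>2)"
  have "reflection w x * reflection w y
      = x * y - emb ?c * (w * y) - emb ?d * (w * x) + emb (?c * ?d) * w\<^sup>2"
    unfolding reflection_def emb_mult by (simp add: power2_eq_square algebra_simps)
  then have "T (reflection w x * reflection w y)
      = T (x * y) - ?c * T (w * y) - ?d * T (w * x) + (?c * ?d) * T (w\<^sup>2)"
    by (simp add: T_add T_diff T_smult)
  also have "\<dots> = T (x * y)"
    using assms by (simp add: field_simps)
  finally show ?thesis .
qed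

lemma reflection_reflection:
  assumes "T (w\<^sup>2) \<noteq> 0"
  shows "reflection w (reflection w x) = x"
proof -
  let ?c = "2 * T (w * x) / T (w\<^sup>2)"
  have "T (w * reflection w x) = T (w * x) - T (emb ?c * w\<^sup>2)"
    unfolding reflection_def by (simp add: T_diff power2_eq_square algebra_simps)
  also have "\<dots> = - T (w * x)"
    using assms by (simp add: T_smult)
  finally show ?thesis
    by (simp add: reflection_def emb_minus)
qed

text \<open>Equal norms give \<open>T ((a - b)\<^sup>2) = 2 * T ((a - b) * a)\<close>, so the
  coefficient in the reflection is 1 and \<open>a\<close> goes to
  \<open>a - (a - b)\<close>.\<close>

lemma reflection_diff:
  assumes "T (a\<^sup>2) = T (b\<^sup>2)" and "T ((a - b)\<^sup>2) \<noteq> 0"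
  shows "reflection (a - b) a = b"
proof -
  have "(a - b)\<^sup>2 = a\<^sup>2 + b\<^sup>2 - (a * b + a * b)" and "(a - b) * a = a\<^sup>2 - a * b"
    by (simp_all add: power2_eq_square algebra_simps)
  then have "T ((a - b)\<^sup>2) = 2 * T ((a - b) * a)"
    using assms(1) by (simp only: T_diff T_add) (simp add: algebra_simps)
  then have "2 * T ((a - b) * a) / T ((a - b)\<^sup>2) = 1"
    using assms(2) by simp
  then show ?thesis
    by (simp add: reflection_def emb_1)
qed

text \<open>An isometry taking \<open>a\<close> to \<open>b\<close> maps the solution set for
  \<open>a\<close> onto the one for \<open>b\<close>.\<close>

lemma M_eq_of_reflection:
  assumes "T (w\<^sup>2) \<noteq> 0" and "reflection w a = b"
  shows "M v a \<rho> = M v b \<rho>"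
proof -
  have b: "reflection w b = a"
    using assms reflection_reflection by blast
  have sq: "T ((reflection w x)\<^sup>2) = T (x\<^sup>2)" for x
    using T_reflection_mult[OF assms(1)] by (simp add: power2_eq_square)
  have ab: "T (b * reflection w x) = T (a * x)" "T (a * reflection w x) = T (b * x)" for x
    using T_reflection_mult[OF assms(1), of a x] T_reflection_mult[OF assms(1), of b x]
    by (simp_all add: assms(2) b)
  show ?thesis
    unfolding M_def
    by (rule bij_betw_same_card[of "reflection w"],
        rule bij_betw_byWitness[where f' = "reflection w"])
      (auto simp: reflection_reflection[OF assms(1)] sq ab)
qed

text \<open>Scaling \<open>x\<close> by \<open>c\<close> preserves \<open>T (x\<^sup>2) = 0\<close>
  and multiplies \<open>T (a * x)\<close> by \<open>c\<close>. Hence all nonzero symbols are equally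
  frequent in a codeword.\<close>

lemma M_smult:
  assumes "c \<noteq> 0"
  shows "M 0 a (c * \<rho>) = M 0 a \<rho>"
proof -
  have inv: "emb (inverse c) * (emb c * x) = x" "emb c * (emb (inverse c) * x) = x" for x
    using assms by (simp_all add: emb_1 flip: emb_mult mult.assoc)
  have "M 0 a \<rho> = M 0 a (c * \<rho>)"
    unfolding M_def
    by (rule bij_betw_same_card[of "\<lambda>x. emb c * x"],
        rule bij_betw_byWitness[where f' = "\<lambda>x. emb (inverse c) * x"])
      (use assms in \<open>auto simp: inv T_square_smult T_smult mult.left_commute[of a]\<close>)
  then show ?thesis by simp
qed

lemma M_minus: "M 0 (- a) \<rho> = M 0 a \<rho>"
proof -
  have "M 0 (- a) \<rho> = M 0 a ((- 1) * \<rho>)"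
    by (auto simp: M_def T_minus intro!: arg_cong[where f = card])
  then show ?thesis
    by (subst (asm) M_smult) simp_all
qed

text \<open>A form of Witt's theorem: since \<open>T ((a - b)\<^sup>2) + T ((a + b)\<^sup>2) = 4 * T (a\<^sup>2)\<close>,
  one of the reflections in \<open>a - b\<close> and \<open>a + b\<close> exists; it sends \<open>a\<close> to \<open>b\<close> or to \<open>- b\<close>.\<close>

lemma M_eq_of_T_square_eq:
  assumes ab: "T (a\<^sup>2) = T (b\<^sup>2)" and nz: "T (a\<^sup>2) \<noteq> 0"
  shows "M 0 a \<rho> = M 0 b \<rho>"
proof (cases "T ((a - b)\<^sup>2) = 0")
  case False
  then show ?thesis
    using reflection_diff[OF ab] M_eq_of_reflection by blast
next
  case True
  have "(a - b)\<^sup>2 + (a - - b)\<^sup>2 = a\<^sup>2 + a\<^sup>2 + (b\<^sup>2 + b\<^sup>2)"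
    by (simp add: power2_eq_square algebra_simps)
  then have "T ((a - b)\<^sup>2) + T ((a - - b)\<^sup>2) = 2 * 2 * T (a\<^sup>2)"
    by (metis T_add ab mult_2 mult.assoc)
  then have w: "T ((a - - b)\<^sup>2) \<noteq> 0"
    using True nz two_nonzero by (metis add_0 mult_eq_0_iff)
  have "reflection (a - - b) a = - b"
    by (rule reflection_diff) (use ab w in simp_all)
  then have "M 0 a \<rho> = M 0 (- b) \<rho>"
    using M_eq_of_reflection[OF w] by blast
  then show ?thesis
    by (simp add: M_minus)
qed

text \<open>Double count of the pairs \<open>(b, x)\<close> with
  \<open>T (b\<^sup>2) = T (a\<^sup>2)\<close>, \<open>T (x\<^sup>2) = 0\<close> and
  \<open>T (b * x) = \<rho>\<close>. For fixed \<open>b\<close> the count is that of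
  \<open>a\<close> by \<open>M_eq_of_T_square_eq\<close>; for fixed \<open>x\<close> it is known
  from \<open>M_isotropic\<close>.\<close>

lemma N_mult_M:
  assumes "T (a\<^sup>2) \<noteq> 0" and "\<rho> \<noteq> 0"
  shows "CARD('k)\<^sup>2 * (N (T (a\<^sup>2)) * M 0 a \<rho>) = (N 0 - 1) * CARD('a)"
proof -
  define v where "v = T (a\<^sup>2)"
  have "N v * M 0 a \<rho> = (\<Sum>b | T (b\<^sup>2) = v. M 0 b \<rho>)"
  proof -
    have "(\<Sum>b | T (b\<^sup>2) = v. M 0 b \<rho>) = (\<Sum>b | T (b\<^sup>2) = v. M 0 a \<rho>)"
      using assms(1) by (intro sum.cong refl M_eq_of_T_square_eq) (auto simp: v_def)
    then show ?thesis
      by (simp add: N_def)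
  qed
  also have "\<dots> = (\<Sum>b | T (b\<^sup>2) = v. \<Sum>x\<in>{x\<in>{x. T (x\<^sup>2) = 0}. T (b * x) = \<rho>}. 1)"
    by (simp add: M_def)
  also have "\<dots> = (\<Sum>x | T (x\<^sup>2) = 0. \<Sum>b\<in>{b\<in>{b. T (b\<^sup>2) = v}. T (b * x) = \<rho>}. 1)"
    by (rule sum.swap_restrict) simp_all
  also have "\<dots> = (\<Sum>x | T (x\<^sup>2) = 0. M v x \<rho>)"
    by (simp add: M_def mult.commute)
  \<comment> \<open>The term \<open>x = 0\<close> vanishes, since \<open>T (b * 0) = 0\<close>
    differs from \<open>\<rho>\<close>.\<close>
  also have "\<dots> = (\<Sum>x\<in>{x. T (x\<^sup>2) = 0} - {0}. M v x \<rho>)"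
    using assms(2) by (intro sum.mono_neutral_right) (auto simp: M_def T_0)
  finally have "CARD('k)\<^sup>2 * (N v * M 0 a \<rho>)
      = (\<Sum>x\<in>{x. T (x\<^sup>2) = 0} - {0}. CARD('k) * (CARD('k) * M v x \<rho>))"
    by (simp add: sum_distrib_left power2_eq_square mult.assoc)
  also have "\<dots> = (\<Sum>x\<in>{x. T (x\<^sup>2) = 0} - {0}. CARD('a))"
    using assms(2) by (intro sum.cong refl) (simp add: M_isotropic card_T_mult_eq)
  also have "\<dots> = (N 0 - 1) * CARD('a)"
    by (simp add: N_def T_0)
  finally show ?thesis by (simp add: v_def)
qed

lemma M_sum: "N 0 = M 0 a 0 + (CARD('k) - 1) * M 0 a 1"
proof -
  have "N 0 = (\<Sum>\<rho>\<in>UNIV. M 0 a \<rho>)"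
    unfolding N_def M_def by (subst card_eq_sum_fibres[where f = "\<lambda>x. T (a * x)"]) simp_all
  also have "\<dots> = M 0 a 0 + (\<Sum>\<rho>\<in>UNIV - {0}. M 0 a \<rho>)"
    by (subst sum.remove[of UNIV 0]) simp_all
  also have "(\<Sum>\<rho>\<in>UNIV - {0}. M 0 a \<rho>) = (\<Sum>\<rho>\<in>UNIV - {0::'k}. M 0 a 1)"
  proof (intro sum.cong refl)
    fix \<rho> :: 'k assume "\<rho> \<in> UNIV - {0}"
    then show "M 0 a \<rho> = M 0 a 1"
      using M_smult[of \<rho> a 1] by simp
  qed
  finally show ?thesis by simp
qed

section \<open>Distribution of the values of \<open>T (x\<^sup>2)\<close>\<close>

lemma N_smult:
  assumes "\<And>x. T ((h * x)\<^sup>2) = c * T (x\<^sup>2)" and "h \<noteq> 0" and "c \<noteq> 0"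
  shows "N (c * v) = N v"
proof -
  have "T ((x / h)\<^sup>2) = v" if "T (x\<^sup>2) = c * v" for x
    using that assms(1)[of "x / h"] assms(2,3) by simp
  then have "N v = N (c * v)"
    unfolding N_def
    by (intro bij_betw_same_card[of "\<lambda>x. h * x"] bij_betw_byWitness[where f' = "\<lambda>x. x / h"])
      (auto simp: assms)
  then show ?thesis by simp
qed

lemma N_square_smult: "c \<noteq> 0 \<Longrightarrow> N (c\<^sup>2 * v) = N v"
  by (rule N_smult[of "emb c"]) (simp_all add: T_square_smult emb_nonzero)

lemma sum_N: "(\<Sum>v\<in>UNIV. N v) = CARD('a)"
  unfolding N_def by (subst card_eq_sum_fibres[where f = "\<lambda>x. T (x\<^sup>2)"]) simp_all

text \<open>Both sides count pairs with \<open>T (x\<^sup>2) = T (y\<^sup>2)\<close>, that is, \<open>T ((x - y) * (x + y)) = 0\<close>.\<close>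

lemma sum_N_square:
  "CARD('k) * (\<Sum>v\<in>UNIV. (N v)\<^sup>2) = CARD('k) * CARD('a) + (CARD('a) - 1) * CARD('a)"
proof -
  let ?S = "SIGMA x:(UNIV::'a set). {y. T (x\<^sup>2) = T (y\<^sup>2)}"
    and ?P = "SIGMA u:(UNIV::'a set). {w. T (u * w) = 0}"
  have "(\<Sum>v\<in>UNIV. (N v)\<^sup>2) = (\<Sum>v\<in>UNIV. \<Sum>x | T (x\<^sup>2) = v. N v)"
    by (simp add: N_def power2_eq_square)
  also have "\<dots> = (\<Sum>x\<in>UNIV. N (T (x\<^sup>2)))"
    by (subst sum.group[of UNIV UNIV "\<lambda>x. T (x\<^sup>2)" "\<lambda>x. N (T (x\<^sup>2))", symmetric])
      (auto intro!: sum.cong)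
  also have "\<dots> = card ?S"
  proof -
    have "N (T (x\<^sup>2)) = card {y. T (x\<^sup>2) = T (y\<^sup>2)}" for x
      unfolding N_def by (rule arg_cong[where f = card]) auto
    then show ?thesis
      by (subst card_SigmaI) simp_all
  qed
  also have "\<dots> = card ?P"
  proof (rule bij_betw_same_card[of "\<lambda>(x, y). (x - y, x + y)"],
      rule bij_betw_byWitness[where f' = "\<lambda>(u, w). ((u + w) / 2, (w - u) / 2)"])
    have half: "(z + z) / 2 = z" for z :: 'a
      using two_nonzero' by (metis mult_2 nonzero_mult_div_cancel_left)
    have "((x - y) + (x + y)) / 2 = x" "((x + y) - (x - y)) / 2 = y" for x y :: 'a
      using half[of x] half[of y] by simp_all
    then show "\<forall>z\<in>?S. (case case z of (x, y) \<Rightarrow> (x - y, x + y) of (u, w) \<Rightarrow> ((u + w) / 2, (w - u) / 2)) = z"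
      by (auto simp only: prod.case)
    have uw: "(u + w) / 2 - (w - u) / 2 = u" "(u + w) / 2 + (w - u) / 2 = w" for u w :: 'a
      using half[of u] half[of w] by (simp_all flip: diff_divide_distrib add_divide_distrib)
    then show "\<forall>z\<in>?P. (case case z of (u, w) \<Rightarrow> ((u + w) / 2, (w - u) / 2) of (x, y) \<Rightarrow> (x - y, x + y)) = z"
      by (auto simp only: prod.case)
    have iff: "T (x\<^sup>2) = T (y\<^sup>2) \<longleftrightarrow> T ((x - y) * (x + y)) = 0" for x y
    proof -
      have "(x - y) * (x + y) = x\<^sup>2 - y\<^sup>2"
        by (simp add: power2_eq_square algebra_simps)
      then show ?thesis
        by (simp add: T_diff)
    qed
    then show "(\<lambda>(x, y). (x - y, x + y)) ` ?S \<subseteq> ?P"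
      by auto
    show "(\<lambda>(u, w). ((u + w) / 2, (w - u) / 2)) ` ?P \<subseteq> ?S"
      by (auto simp only: mem_Sigma_iff UNIV_I mem_Collect_eq iff uw)
  qed
  also have "\<dots> = (\<Sum>u\<in>UNIV. card {w. T (u * w) = 0})"
    by (subst card_SigmaI) auto
  also have "\<dots> = card {w. T (0 * w) = 0} + (\<Sum>u\<in>UNIV - {0}. card {w. T (u * w) = 0})"
    by (subst sum.remove[of UNIV 0]) auto
  finally have "CARD('k) * (\<Sum>v\<in>UNIV. (N v)\<^sup>2)
      = CARD('k) * CARD('a) + (\<Sum>u\<in>UNIV - {0}. CARD('k) * card {w. T (u * w) = 0})"
    by (simp add: sum_distrib_left distrib_left T_0)
  also have "(\<Sum>u\<in>UNIV - {0}. CARD('k) * card {w. T (u * w) = 0}) = (CARD('a) - 1) * CARD('a)"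
    by (simp add: card_T_mult_eq)
  finally show ?thesis .
qed

text \<open>The zero word, the nonzero isotropic \<open>a\<close> and the anisotropic
  \<open>a\<close> are separated because they give different terms of the enumerator.\<close>

lemma sum_by_T_square:
  fixes f :: "'a \<Rightarrow> 'c::comm_monoid_add"
  shows "(\<Sum>a\<in>UNIV. f a) = f 0 + (\<Sum>a\<in>{a. T (a\<^sup>2) = 0} - {0}. f a)
    + (\<Sum>v\<in>UNIV - {0}. \<Sum>a | T (a\<^sup>2) = v. f a)"
proof -
  have "(\<Sum>a\<in>UNIV. f a) = (\<Sum>v\<in>UNIV. \<Sum>a | T (a\<^sup>2) = v. f a)"
    using sum.group[of UNIV UNIV "\<lambda>a. T (a\<^sup>2)" f] by simp
  also have "\<dots> = (\<Sum>a | T (a\<^sup>2) = 0. f a) + (\<Sum>v\<in>UNIV - {0}. \<Sum>a | T (a\<^sup>2) = v. f a)"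
    by (rule sum.remove) simp_all
  also have "(\<Sum>a | T (a\<^sup>2) = 0. f a) = f 0 + (\<Sum>a\<in>{a. T (a\<^sup>2) = 0} - {0}. f a)"
    by (rule sum.remove) (simp_all add: T_0)
  finally show ?thesis .
qed

lemma M_0_eq: "M 0 0 0 = N 0" "M 0 0 1 = 0"
  by (simp_all add: M_def N_def T_0)

lemma M_isotropic_eq:
  assumes "CARD('a) = CARD('k)\<^sup>2 * c" and "a \<noteq> 0" and "T (a\<^sup>2) = 0"
  shows "M 0 a 1 = c"
proof -
  have "CARD('k) * (CARD('k) * M 0 a 1) = CARD('k) * (CARD('k) * c)"
    using assms M_isotropic[of a 1 0] card_T_mult_eq[of a 1]
    by (simp add: power2_eq_square mult.assoc)
  then show ?thesis by simp
qed

lemma int_M_0: "int (M 0 a 0) = int (N 0) - (int CARD('k) - 1) * int (M 0 a 1)"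
  using M_sum[of a] by simp

lemma N_0_ge_1: "N 0 \<ge> 1"
proof -
  have "card {0::'a} \<le> N 0"
    unfolding N_def by (rule card_mono) (simp_all add: T_0)
  then show ?thesis by simp
qed

lemma N_T_square_pos: "N (T (a\<^sup>2)) > 0"
  unfolding N_def by (auto simp: card_gt_0_iff)

lemma int_N_mult_M:
  assumes "T (a\<^sup>2) \<noteq> 0" and "CARD('a) = CARD('k)\<^sup>2 * c"
  shows "int (N (T (a\<^sup>2))) * int (M 0 a 1) = (int (N 0) - 1) * int c"
proof -
  have "CARD('k)\<^sup>2 * (N (T (a\<^sup>2)) * M 0 a 1) = CARD('k)\<^sup>2 * ((N 0 - 1) * c)"
    using N_mult_M[OF assms(1), of 1] assms(2) by (simp add: mult_ac)
  then have "N (T (a\<^sup>2)) * M 0 a 1 = (N 0 - 1) * c"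
    by simp
  then show ?thesis
    using N_0_ge_1 by (metis of_nat_1 of_nat_diff of_nat_mult)
qed

end

section \<open>Even degree\<close>

text \<open>For \<open>CARD('k) = p\<close> and \<open>CARD('a) = p ^ m\<close> with \<open>m\<close> even, \<open>s = p ^ ((m - 2) / 2)\<close> and
  \<open>Q = p ^ (m / 2)\<close>; the sign \<open>\<epsilon>\<close> of the theorem is \<open>sg\<close> below.\<close>

locale quadratic_trace_even = quadratic_trace emb T
  for emb :: "'k::{field,finite} \<Rightarrow> 'a::{field,finite}" and T +
  fixes s Q :: nat
  assumes Q_eq: "Q = CARD('k) * s"
    and card_field: "CARD('a) = Q\<^sup>2"
    and frob_add: "(x + y :: 'a) ^ Q = x ^ Q + y ^ Q"
    and frob_emb: "emb c ^ Q = emb c"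
    and T_frob: "T (x ^ Q) = T x"
    and odd_Q: "odd Q"
begin

definition sg :: int where
  "sg = (if Q mod 4 = 3 then - 1 else 1)"

definition K :: "'a set" where
  "K = {t. t ^ Q = t}"

lemma sg_square: "sg * sg = 1"
  by (simp add: sg_def)

lemma s_pos: "s > 0"
  using odd_Q Q_eq by (intro gr0I) auto

lemma Q_gt_1: "Q > 1"
  using s_pos card_k_gt_1 by (cases s) (simp_all add: Q_eq)

lemma frob_frob: "((x::'a) ^ Q) ^ Q = x"
proof -
  have "x ^ CARD('a) = x"
    by (rule finite_field_power_card)
  then show ?thesis
    by (simp only: card_field power2_eq_square power_mult)
qed

text \<open>\<open>x + x ^ Q\<close> is the relative trace to \<open>K\<close>, and invariance of
  \<open>T\<close> under the \<open>Q\<close>-th power gives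
  \<open>T ((x + x ^ Q) * y) = T (x * (y + y ^ Q))\<close>; nondegeneracy then forces
  \<open>y + y ^ Q = 0\<close>. Conversely, this equation makes \<open>T (t * y)\<close> its own
  negative for \<open>t\<close> in \<open>K\<close>.\<close>

lemma K_mult_orthogonal_iff: "(\<forall>t\<in>K. T (t * y) = 0) \<longleftrightarrow> y + y ^ Q = 0"
proof
  assume orth: "\<forall>t\<in>K. T (t * y) = 0"
  have "T (x * (y + y ^ Q)) = 0" for x
  proof -
    have "x + x ^ Q \<in> K"
      unfolding K_def mem_Collect_eq frob_add frob_frob by (rule add.commute)
    then have "0 = T ((x + x ^ Q) * y)"
      using orth by simp
    also have "\<dots> = T (x * y) + T (x ^ Q * y)"
      by (simp only: distrib_right T_add)
    also have "T (x ^ Q * y) = T (x * y ^ Q)"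
      using T_frob[of "x ^ Q * y"] by (simp only: power_mult_distrib frob_frob)
    finally show ?thesis
      by (simp only: distrib_left T_add)
  qed
  then show "y + y ^ Q = 0"
    using T_mult_nonzero by blast
next
  assume y: "y + y ^ Q = 0"
  show "\<forall>t\<in>K. T (t * y) = 0"
  proof
    fix t assume "t \<in> K"
    then have "T (t * y) = T (t * y ^ Q)"
      using T_frob[of "t * y"] by (simp only: K_def mem_Collect_eq power_mult_distrib)
    moreover have "T (t * y) + T (t * y ^ Q) = T (t * (y + y ^ Q))"
      by (simp only: distrib_left T_add)
    ultimately have "2 * T (t * y) = 0"
      by (simp add: y T_0)
    then show "T (t * y) = 0"
      using two_nonzero by simp
  qed
qed

lemma card_K: "card K = Q"
  unfolding K_def by (rule card_power_eq_self) (rule card_field)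

text \<open>Either all of \<open>K\<close> is orthogonal to \<open>y\<close>, or the orthogonal
  elements form a hyperplane of \<open>K\<close>, with Q / p = \<open>s\<close> elements; 0 is then
  removed.\<close>

lemma card_K_orthogonal: "card {t\<in>K - {0}. T (t * y) = 0} = (if y + y ^ Q = 0 then Q - 1 else s - 1)"
proof -
  have zero: "0 \<in> K"
    using Q_gt_1 by (simp add: K_def power_0_left)
  have "{t\<in>K - {0}. T (t * y) = 0} = {t\<in>K. T (t * y) = 0} - {0}"
    by auto
  then have card: "card {t\<in>K - {0}. T (t * y) = 0} = card {t\<in>K. T (t * y) = 0} - 1"
    using zero by (simp add: T_0)
  show ?thesis
  proof (cases "y + y ^ Q = 0")
    case True
    then have "{t\<in>K. T (t * y) = 0} = K"
      using K_mult_orthogonal_iff by blast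
    then show ?thesis
      using card True card_K by simp
  next
    case False
    then obtain e where e: "e \<in> K" "T (e * y) \<noteq> 0"
      using K_mult_orthogonal_iff by blast
    have "CARD('k) * card {t\<in>K. T (t * y) = 0} = card K"
    proof (rule card_hyperplane[of K, OF _ _ e])
      show "x + z \<in> K" if "x \<in> K" "z \<in> K" for x z
        using that by (simp only: K_def mem_Collect_eq frob_add)
      show "emb c * t \<in> K" if "t \<in> K" for c t
        using that by (simp only: K_def mem_Collect_eq power_mult_distrib frob_emb)
    qed
    also have "card K = CARD('k) * s"
      using card_K Q_eq by (rule trans)
    finally have "CARD('k) * card {t\<in>K. T (t * y) = 0} = CARD('k) * s" .
    then show ?thesis
      using card False by simp
  qed
qed

lemma K_square: "t \<in> K \<Longrightarrow> \<exists>u. t = u\<^sup>2"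
  using square_of_power_eq_self[OF two_nonzero' card_field odd_Q] by (simp add: K_def)

text \<open>Division by \<open>x\<^sup>2\<close> leads to the equation counted in
  \<open>card_power_eq_minus_1\<close>.\<close>

lemma card_antisymmetric_squares:
  "card {x\<in>UNIV - {0::'a}. x\<^sup>2 + (x\<^sup>2) ^ Q = 0} = (if Q mod 4 = 3 then 2 * (Q - 1) else 0)"
proof -
  have "x\<^sup>2 + (x\<^sup>2) ^ Q = 0 \<longleftrightarrow> x ^ (2 * (Q - 1)) = - 1" if "x \<noteq> 0" for x :: 'a
  proof -
    have "(x\<^sup>2) ^ Q = x\<^sup>2 * x ^ (2 * (Q - 1))"
    proof -
      have "(x\<^sup>2) ^ Q = x\<^sup>2 * (x\<^sup>2) ^ (Q - 1)"
        using Q_gt_1 by (cases Q) simp_all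
      then show ?thesis
        by (simp only: power_mult)
    qed
    then have "x\<^sup>2 + (x\<^sup>2) ^ Q = x\<^sup>2 * (1 + x ^ (2 * (Q - 1)))"
      by (simp add: distrib_left)
    then show ?thesis
      using that by (simp add: add_eq_0_iff)
  qed
  moreover have "x \<noteq> 0" if "x ^ (2 * (Q - 1)) = - 1" for x :: 'a
    using that Q_gt_1 by (auto simp: power_0_left)
  ultimately have "{x\<in>UNIV - {0::'a}. x\<^sup>2 + (x\<^sup>2) ^ Q = 0} = {x. x ^ (2 * (Q - 1)) = - 1}"
    by blast
  then show ?thesis
    using card_power_eq_minus_1[OF two_nonzero' card_field odd_Q Q_gt_1] by simp
qed

text \<open>Both sides count pairs \<open>(t, x)\<close> with \<open>T (t * x\<^sup>2) = 0\<close>, where \<open>t\<close> runs through the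
  nonzero elements of the subfield \<open>K\<close> of order \<open>Q\<close>. They are squares, which gives the left-hand side.\<close>

lemma N_0_double_count:
  "(Q - 1) * (N 0 - 1) = (\<Sum>x\<in>UNIV - {0::'a}. if x\<^sup>2 + (x\<^sup>2) ^ Q = 0 then Q - 1 else s - 1)"
proof -
  have zero: "0 \<in> K"
    using Q_gt_1 by (simp add: K_def power_0_left)
  have count: "card {x\<in>UNIV - {0}. T (t * x\<^sup>2) = 0} = N 0 - 1" if t: "t \<in> K - {0}" for t
  proof -
    obtain u where u: "t = u\<^sup>2"
      using t K_square by blast
    \<comment> \<open>The substitution of \<open>u * x\<close> for \<open>x\<close> absorbs
      \<open>t = u\<^sup>2\<close> into the square.\<close>
    have "card {x\<in>UNIV - {0}. T (t * x\<^sup>2) = 0} = card ({x. T (x\<^sup>2) = 0} - {0})"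
      by (rule bij_betw_same_card[of "\<lambda>x. u * x"], rule bij_betw_byWitness[where f' = "\<lambda>x. x / u"])
        (use t u in \<open>auto simp: power_mult_distrib power_divide\<close>)
    then show ?thesis
      by (simp add: N_def T_0)
  qed
  have "(Q - 1) * (N 0 - 1) = (\<Sum>t\<in>K - {0}. N 0 - 1)"
    using zero by (simp add: card_K)
  also have "\<dots> = (\<Sum>t\<in>K - {0}. card {x\<in>UNIV - {0}. T (t * x\<^sup>2) = 0})"
    by (rule sum.cong[OF refl]) (rule count[symmetric])
  also have "\<dots> = (\<Sum>t\<in>K - {0}. \<Sum>x\<in>{x\<in>UNIV - {0}. T (t * x\<^sup>2) = 0}. 1)"
    by simp
  also have "\<dots> = (\<Sum>x\<in>UNIV - {0}. \<Sum>t\<in>{t\<in>K - {0}. T (t * x\<^sup>2) = 0}. 1)"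
    by (rule sum.swap_restrict) simp_all
  also have "\<dots> = (\<Sum>x\<in>UNIV - {0}. card {t\<in>K - {0}. T (t * x\<^sup>2) = 0})"
    by simp
  finally show ?thesis
    by (simp only: card_K_orthogonal)
qed

text \<open>Evaluation of \<open>N_0_double_count\<close>: each element of \<open>?Z\<close>
  contributes \<open>Q - 1\<close>, every other nonzero \<open>x\<close> contributes
  \<open>s - 1\<close>. Dividing by \<open>Q - 1\<close> leaves \<open>(Q - 1) * (s + 1)\<close> or
  \<open>(Q + 1) * (s - 1)\<close>, and \<open>sg\<close> unites the two.\<close>

lemma int_N_0: "int (N 0) - 1 = (int CARD('k) * int s + sg) * (int s - sg)"
proof -
  let ?Z = "{x\<in>UNIV - {0::'a}. x\<^sup>2 + (x\<^sup>2) ^ Q = 0}"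
  have "(\<Sum>x\<in>UNIV - {0::'a}. if x\<^sup>2 + (x\<^sup>2) ^ Q = 0 then Q - 1 else s - 1)
      = (\<Sum>x\<in>?Z. Q - 1) + (\<Sum>x\<in>(UNIV - {0}) - ?Z. s - 1)"
    by (subst sum.If_cases) (auto intro!: arg_cong2[where f = "(+)"] arg_cong[where f = card])
  also have "\<dots> = card ?Z * (Q - 1) + (CARD('a) - 1 - card ?Z) * (s - 1)"
    by (subst (2) sum_constant, subst card_Diff_subset) auto
  finally have eq: "(Q - 1) * (N 0 - 1) = card ?Z * (Q - 1) + (Q\<^sup>2 - 1 - card ?Z) * (s - 1)"
    using N_0_double_count card_field by simp
  define qi si where "qi = int Q" and "si = int s"
  have qi: "int (Q - 1) = qi - 1" "int (s - 1) = si - 1" "int (N 0 - 1) = int (N 0) - 1"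
    using Q_gt_1 s_pos N_0_ge_1 by (simp_all add: qi_def si_def)
  have "(qi - 1) * (int (N 0) - 1) = (qi - 1) * ((qi + sg) * (si - sg))"
  proof (cases "Q mod 4 = 3")
    case True
    then have Z: "card ?Z = 2 * (Q - 1)"
      using card_antisymmetric_squares by simp
    have "Q\<^sup>2 - 1 - 2 * (Q - 1) = (Q - 1) * (Q - 1)"
      using Q_gt_1 by (cases Q) (simp_all add: power2_eq_square algebra_simps)
    then have "(Q - 1) * (N 0 - 1) = 2 * (Q - 1) * (Q - 1) + (Q - 1) * (Q - 1) * (s - 1)"
      using eq unfolding Z by simp
    then have "int ((Q - 1) * (N 0 - 1)) = int (2 * (Q - 1) * (Q - 1) + (Q - 1) * (Q - 1) * (s - 1))"
      by (rule arg_cong)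
    then have "(qi - 1) * (int (N 0) - 1) = 2 * (qi - 1) * (qi - 1) + (qi - 1) * (qi - 1) * (si - 1)"
      by (simp only: of_nat_mult of_nat_add qi of_nat_numeral)
    then show ?thesis
      using True by (simp add: sg_def algebra_simps)
  next
    case False
    then have Z: "card ?Z = 0"
      using card_antisymmetric_squares by simp
    have "Q\<^sup>2 - 1 = (Q - 1) * (Q + 1)"
      using Q_gt_1 by (cases Q) (simp_all add: power2_eq_square algebra_simps)
    then have "(Q - 1) * (N 0 - 1) = (Q - 1) * (Q + 1) * (s - 1)"
      using eq unfolding Z by simp
    then have "int ((Q - 1) * (N 0 - 1)) = int ((Q - 1) * (Q + 1) * (s - 1))"
      by (rule arg_cong)
    then have "(qi - 1) * (int (N 0) - 1) = (qi - 1) * (qi + 1) * (si - 1)"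
      by (simp only: of_nat_mult of_nat_add qi of_nat_1) (simp add: qi_def)
    then show ?thesis
      using False by (simp add: sg_def algebra_simps)
  qed
  moreover have "qi - 1 \<noteq> 0"
    using Q_gt_1 unfolding qi_def by linarith
  ultimately show ?thesis
    by (simp add: Q_eq qi_def si_def)
qed

text \<open>Scalars lie in \<open>K\<close>, so \<open>v\<close> acquires a square root
  \<open>h\<close> in the extension, and multiplication by \<open>h\<close> multiplies
  \<open>T (x\<^sup>2)\<close> by \<open>v\<close>.\<close>

lemma N_eq_N_1:
  assumes "v \<noteq> 0"
  shows "N v = N 1"
proof -
  have "emb v \<in> K"
    by (simp only: K_def mem_Collect_eq frob_emb)
  then obtain h where h: "emb v = h\<^sup>2"
    using K_square by blast
  have "N (v * 1) = N 1"
  proof (rule N_smult[of h])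
    show "T ((h * x)\<^sup>2) = v * T (x\<^sup>2)" for x
      by (simp only: power_mult_distrib T_smult flip: h)
    show "h \<noteq> 0"
      using h emb_nonzero[OF assms] by auto
  qed fact
  then show ?thesis by simp
qed

text \<open>The values of \<open>N\<close> sum to \<open>Q\<^sup>2\<close> and agree off 0, so
  \<open>N 0\<close> determines them.\<close>

lemma int_N_nonzero:
  assumes "v \<noteq> 0"
  shows "int (N v) = int s * (int CARD('k) * int s + sg)"
proof -
  define qi si where "qi = int CARD('k)" and "si = int s"
  have "(\<Sum>v\<in>UNIV. N v) = N 0 + (\<Sum>v\<in>UNIV - {0}. N v)"
    by (rule sum.remove) simp_all
  also have "(\<Sum>v\<in>UNIV - {0}. N v) = (\<Sum>v\<in>UNIV - {0::'k}. N 1)"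
    by (rule sum.cong[OF refl]) (rule N_eq_N_1, simp)
  finally have "Q\<^sup>2 = N 0 + (CARD('k) - 1) * N 1"
    by (simp add: sum_N card_field)
  then have "int (Q\<^sup>2) = int (N 0 + (CARD('k) - 1) * N 1)"
    by (rule arg_cong)
  then have "(qi * si)\<^sup>2 = int (N 0) + (qi - 1) * int (N 1)"
    using card_k_gt_1 by (simp add: Q_eq qi_def si_def)
  also have "int (N 0) = 1 + (qi * si + sg) * (si - sg)"
    using int_N_0 by (simp add: qi_def si_def)
  finally have "(qi - 1) * int (N 1) = (qi * si)\<^sup>2 - 1 - (qi * si + sg) * (si - sg)"
    by simp
  also have "\<dots> = (qi - 1) * (si * (qi * si + sg)) + (sg * sg - 1)"
    by (simp add: power2_eq_square algebra_simps)
  finally have "(qi - 1) * int (N 1) = (qi - 1) * (si * (qi * si + sg))"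
    by (simp only: sg_square)
  moreover have "qi - 1 \<noteq> 0"
    using card_k_gt_1 unfolding qi_def by linarith
  ultimately have "int (N 1) = si * (qi * si + sg)"
    by simp
  then show ?thesis
    by (simp add: N_eq_N_1[OF assms] qi_def si_def)
qed

section \<open>Weights of the codewords in even degree\<close>

lemma card_field': "CARD('a) = CARD('k)\<^sup>2 * s\<^sup>2"
  by (simp add: card_field Q_eq power_mult_distrib)

lemma M_anisotropic:
  assumes "T (a\<^sup>2) \<noteq> 0"
  shows "int (M 0 a 1) = int s * (int s - sg)" and "M 0 a 0 = s\<^sup>2"
proof -
  define qi si where "qi = int CARD('k)" and "si = int s"
  have N: "int (N (T (a\<^sup>2))) = si * (qi * si + sg)" "int (N 0) - 1 = (qi * si + sg) * (si - sg)"
    using int_N_nonzero[OF assms] int_N_0 by (simp_all add: qi_def si_def)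
  \<comment> \<open>This factor is \<open>N (T (a\<^sup>2))\<close>, which counts \<open>a\<close>
    itself; it can therefore be cancelled.\<close>
  have "si * (qi * si + sg) \<noteq> 0"
    using N(1) N_T_square_pos[of a] by linarith
  moreover have "si * (qi * si + sg) * int (M 0 a 1) = si * (qi * si + sg) * (si * (si - sg))"
    using int_N_mult_M[OF assms card_field'] unfolding N by (simp add: si_def power2_eq_square mult_ac)
  ultimately have M1: "int (M 0 a 1) = si * (si - sg)"
    by simp
  then show "int (M 0 a 1) = int s * (int s - sg)"
    by (simp add: si_def)
  have "int (M 0 a 0) = 1 + (qi * si + sg) * (si - sg) - (qi - 1) * (si * (si - sg))"
    using int_M_0[of a] N(2) by (simp add: M1 qi_def)
  also have "\<dots> = si\<^sup>2 + (1 - sg * sg)"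
    by (simp add: power2_eq_square algebra_simps)
  finally have "int (M 0 a 0) = int (s\<^sup>2)"
    by (simp add: sg_square si_def)
  then show "M 0 a 0 = s\<^sup>2"
    by (simp only: of_nat_eq_iff)
qed

lemma M_isotropic_even:
  assumes "a \<noteq> 0" and "T (a\<^sup>2) = 0"
  shows "M 0 a 1 = s\<^sup>2" and "int (M 0 a 0) = (int s)\<^sup>2 - sg * (int CARD('k) - 1) * int s"
proof -
  define qi si where "qi = int CARD('k)" and "si = int s"
  show M1: "M 0 a 1 = s\<^sup>2"
    using M_isotropic_eq[OF card_field' assms] .
  have "int (M 0 a 0) = 1 + (qi * si + sg) * (si - sg) - (qi - 1) * si\<^sup>2"
    using int_M_0[of a] int_N_0 by (simp add: M1 qi_def si_def)
  also have "\<dots> = si\<^sup>2 - sg * (qi - 1) * si + (1 - sg * sg)"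
    by (simp add: power2_eq_square algebra_simps)
  finally show "int (M 0 a 0) = (int s)\<^sup>2 - sg * (int CARD('k) - 1) * int s"
    by (simp add: sg_square qi_def si_def)
qed

text \<open>\<open>F\<close> stands for the monomial of a codeword as a function of the two counts
  that determine it. There are \<open>N 0 - 1\<close> nonzero isotropic \<open>a\<close>, and
  \<open>N v\<close> elements for each of the p - 1 values \<open>v \<noteq> 0\<close>.\<close>

lemma sum_M_even:
  fixes F :: "nat \<Rightarrow> nat \<Rightarrow> 'c::comm_ring_1"
  shows "(\<Sum>a\<in>UNIV. F (M 0 a 0) (M 0 a 1)) = F (N 0) 0
    + of_nat (N 0 - 1) * F (nat ((int s)\<^sup>2 - sg * (int CARD('k) - 1) * int s)) (s\<^sup>2)
    + of_int ((int CARD('k) - 1) * (int s * (int CARD('k) * int s + sg)))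
        * F (s\<^sup>2) (nat (int s * (int s - sg)))"
proof -
  let ?A = "F (nat ((int s)\<^sup>2 - sg * (int CARD('k) - 1) * int s)) (s\<^sup>2)"
    and ?B = "F (s\<^sup>2) (nat (int s * (int s - sg)))"
  have "(\<Sum>a\<in>{a. T (a\<^sup>2) = 0} - {0}. F (M 0 a 0) (M 0 a 1)) = (\<Sum>a\<in>{a. T (a\<^sup>2) = 0} - {0}. ?A)"
  proof (rule sum.cong[OF refl])
    fix a assume "a \<in> {a. T (a\<^sup>2) = 0} - {0}"
    then have "M 0 a 1 = s\<^sup>2" "M 0 a 0 = nat ((int s)\<^sup>2 - sg * (int CARD('k) - 1) * int s)"
      using M_isotropic_even[of a] by (simp_all flip: M_isotropic_even(2)[of a])
    then show "F (M 0 a 0) (M 0 a 1) = ?A"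
      by simp
  qed
  moreover have "(\<Sum>v\<in>UNIV - {0}. \<Sum>a | T (a\<^sup>2) = v. F (M 0 a 0) (M 0 a 1))
      = (\<Sum>v\<in>UNIV - {0}. \<Sum>a | T (a\<^sup>2) = v. ?B)"
  proof (intro sum.cong refl)
    fix v a assume "v \<in> UNIV - {0}" "a \<in> {a. T (a\<^sup>2) = v}"
    then have "M 0 a 0 = s\<^sup>2" "M 0 a 1 = nat (int s * (int s - sg))"
      using M_anisotropic[of a] by (simp_all flip: M_anisotropic(1)[of a])
    then show "F (M 0 a 0) (M 0 a 1) = ?B"
      by simp
  qed
  moreover have "\<dots> = (\<Sum>v\<in>UNIV - {0}. of_int (int (N v)) * ?B)"
    by (simp add: N_def)
  moreover have "\<dots> = (\<Sum>v\<in>UNIV - {0::'k}. of_int (int s * (int CARD('k) * int s + sg)) * ?B)"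
    by (rule sum.cong[OF refl], subst int_N_nonzero) simp_all
  moreover have "\<dots> = of_int ((int CARD('k) - 1) * (int s * (int CARD('k) * int s + sg))) * ?B"
    using card_k_gt_1 by (simp add: mult.assoc)
  moreover have "(\<Sum>a\<in>{a. T (a\<^sup>2) = 0} - {0}. ?A) = of_nat (N 0 - 1) * ?A"
    by (simp add: N_def T_0)
  ultimately show ?thesis
    by (simp only: sum_by_T_square[of "\<lambda>a. F (M 0 a 0) (M 0 a 1)"] M_0_eq)
qed

end

section \<open>Odd degree\<close>

text \<open>Here \<open>s = p ^ ((m - 3) / 2)\<close> and \<open>Q = p ^ ((m - 1) / 2)\<close>.\<close>

locale quadratic_trace_odd = quadratic_trace emb T
  for emb :: "'k::{field,finite} \<Rightarrow> 'a::{field,finite}" and T +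
  fixes s Q :: nat and g :: 'k
  assumes Q_eq: "Q = CARD('k) * s"
    and card_field: "CARD('a) = CARD('k) * Q\<^sup>2"
    and emb_nonsquare: "\<nexists>z. emb g = z\<^sup>2"
begin

lemma emb_g_nonzero: "emb g \<noteq> 0"
  using emb_nonsquare by (metis power_zero_numeral)

lemma g_nonzero: "g \<noteq> 0"
  using emb_g_nonzero emb_0 by blast

lemma g_nonsquare: "\<nexists>z. g = z\<^sup>2"
  using emb_nonsquare by (metis emb_power)

lemma Q_pos: "Q > 0"
  using card_field by (intro gr0I) simp

lemma card_T_preimage: "card {x::'a. T (f x) = v} = (\<Sum>y | T y = v. card {x. f x = y})"
proof -
  have "card {x. T (f x) = v} = (\<Sum>y\<in>UNIV. card {x\<in>{x. T (f x) = v}. f x = y})"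
    by (rule card_eq_sum_fibres) simp
  also have "\<dots> = (\<Sum>y | T y = v. card {x\<in>{x. T (f x) = v}. f x = y})"
    by (rule sum.mono_neutral_right) auto
  also have "\<dots> = (\<Sum>y | T y = v. card {x. f x = y})"
    by (intro sum.cong refl arg_cong[where f = card]) auto
  finally show ?thesis .
qed

text \<open>For \<open>y \<noteq> 0\<close> exactly one of \<open>y\<close> and
  \<open>y / emb g\<close> is a square, with two roots; for \<open>y = 0\<close> each equation has
  the single root 0.\<close>

lemma card_square_roots_add: "card {x. x\<^sup>2 = y} + card {x. emb g * x\<^sup>2 = y} = 2"
proof (cases "y = 0")
  case True
  then show ?thesis
    using emb_g_nonzero by simp
next
  case y: False
  let ?y = "y / emb g"
  have "?y \<noteq> 0"
    using y emb_g_nonzero by simp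
  have "emb g * x\<^sup>2 = y \<longleftrightarrow> x\<^sup>2 = ?y" for x
    using emb_g_nonzero by (simp add: field_simps)
  then have eq: "card {x. emb g * x\<^sup>2 = y} = card {x. x\<^sup>2 = ?y}"
    by simp
  have "(\<exists>x. ?y = x\<^sup>2) \<longleftrightarrow> \<not> (\<exists>x. y = x\<^sup>2)"
  proof
    assume "\<exists>x. ?y = x\<^sup>2"
    then obtain x where x: "?y = x\<^sup>2" by blast
    show "\<not> (\<exists>x. y = x\<^sup>2)"
    proof
      assume "\<exists>x. y = x\<^sup>2"
      then obtain w where w: "y = w\<^sup>2" by blast
      have "emb g = y / ?y"
        using y emb_g_nonzero by simp
      also have "\<dots> = (w / x)\<^sup>2"
        by (simp only: x) (simp add: w power_divide)
      finally show False
        using emb_nonsquare by blast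
    qed
  next
    assume "\<not> (\<exists>x. y = x\<^sup>2)"
    then obtain z where "y * emb g = z\<^sup>2"
      using nonsquare_mult[OF two_nonzero' _ emb_nonsquare] by blast
    then have "?y = (z / emb g)\<^sup>2"
      using emb_g_nonzero by (simp add: power2_eq_square field_simps)
    then show "\<exists>x. ?y = x\<^sup>2" by blast
  qed
  then show ?thesis
    unfolding eq card_square_roots[OF two_nonzero' y] card_square_roots[OF two_nonzero' \<open>?y \<noteq> 0\<close>]
    by simp
qed

text \<open>Sum of \<open>card_square_roots_add\<close> over the affine hyperplane
  \<open>T y = v\<close>, which has \<open>Q\<^sup>2\<close> elements. At \<open>v = 0\<close> both
  terms coincide, which yields \<open>N_0\<close>.\<close>

lemma N_add: "N v + N (v / g) = 2 * Q\<^sup>2"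
proof -
  have "N (v / g) = card {x. T (emb g * x\<^sup>2) = v}"
    unfolding N_def using g_nonzero by (simp add: T_smult field_simps)
  then have "N v + N (v / g) = (\<Sum>y | T y = v. card {x. x\<^sup>2 = y} + card {x. emb g * x\<^sup>2 = y})"
    by (simp add: N_def card_T_preimage sum.distrib)
  also have "\<dots> = 2 * card {y. T (1 * y) = v}"
    by (simp add: card_square_roots_add)
  finally have "CARD('k) * (N v + N (v / g)) = CARD('k) * (2 * Q\<^sup>2)"
    using card_T_mult_eq[of 1 v] card_field by simp
  then show ?thesis by simp
qed

lemma N_0: "N 0 = Q\<^sup>2"
  using N_add[of 0] by simp

lemma N_square: "\<lbrakk>v \<noteq> 0; \<exists>z. v = z\<^sup>2\<rbrakk> \<Longrightarrow> N v = N 1"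
  using N_square_smult[of _ 1] by auto

text \<open>A nonsquare differs from \<open>g\<close> by a square factor, and
  \<open>N_square_smult\<close> removes it.\<close>

lemma N_nonsquare:
  assumes "\<nexists>z. v = z\<^sup>2"
  shows "N v = N g"
proof -
  obtain z where z: "v * g = z\<^sup>2"
    using nonsquare_mult[OF two_nonzero assms g_nonsquare] by blast
  then have "v = (z / g)\<^sup>2 * g"
    using g_nonzero by (simp add: power2_eq_square field_simps)
  moreover have "z \<noteq> 0"
    using z g_nonzero assms by (metis mult_eq_0_iff power_zero_numeral)
  ultimately show ?thesis
    using N_square_smult[of "z / g" g] g_nonzero by simp
qed

text \<open>Half of the nonzero scalars are squares. \<open>f\<close> is general because both the
  second moment and the sum over codewords are evaluated this way.\<close>

lemma sum_N_nonzero: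
  fixes f :: "nat \<Rightarrow> 'c::comm_semiring_1"
  shows "(\<Sum>v\<in>UNIV - {0}. f (N v)) = of_nat ((CARD('k) - 1) div 2) * (f (N 1) + f (N g))"
    and "2 * ((CARD('k) - 1) div 2) = CARD('k) - 1"
proof -
  let ?S = "{v::'k. v \<noteq> 0 \<and> (\<exists>z. v = z\<^sup>2)}" and ?U = "{v::'k. \<nexists>z. v = z\<^sup>2}"
  have S: "2 * card ?S = CARD('k) - 1"
    by (rule card_nonzero_squares) (rule two_nonzero)
  have h: "(CARD('k) - 1) div 2 = card ?S"
    unfolding S[symmetric] by (rule nonzero_mult_div_cancel_left) simp
  then show "2 * ((CARD('k) - 1) div 2) = CARD('k) - 1"
    by (simp only: S)
  have nz: "v \<noteq> 0" if "\<nexists>z. v = z\<^sup>2" for v :: 'k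
    using that by (metis power_zero_numeral)
  then have split: "UNIV - {0} = ?S \<union> ?U" "?S \<inter> ?U = {}"
    by auto
  then have "card (UNIV - {0::'k}) = card ?S + card ?U"
    by (simp only: card_Un_disjoint[OF finite finite])
  then have U: "card ?U = card ?S"
    using S by simp
  have "(\<Sum>v\<in>UNIV - {0}. f (N v)) = (\<Sum>v\<in>?S. f (N v)) + (\<Sum>v\<in>?U. f (N v))"
    unfolding split(1) by (rule sum.union_disjoint) (use split(2) in simp_all)
  also have "(\<Sum>v\<in>?S. f (N v)) = (\<Sum>v\<in>?S. f (N 1))"
    by (intro sum.cong refl arg_cong[where f = f]) (rule N_square, simp_all)
  also have "(\<Sum>v\<in>?U. f (N v)) = (\<Sum>v\<in>?U. f (N g))"
    by (intro sum.cong refl arg_cong[where f = f]) (rule N_nonsquare, simp)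
  finally show "(\<Sum>v\<in>UNIV - {0}. f (N v)) = of_nat ((CARD('k) - 1) div 2) * (f (N 1) + f (N g))"
    by (simp only: sum_constant U h distrib_left)
qed

text \<open>With \<open>N 1 = Q\<^sup>2 + d\<close> and \<open>N g = Q\<^sup>2 - d\<close>, the
  second moment \<open>sum_N_square\<close> gives \<open>d\<^sup>2 = Q\<^sup>2\<close>. The sign of
  \<open>d\<close> stays open; since squares and nonsquares are equally many, the enumerator does
  not depend on it.\<close>

lemma N_1_N_g:
  "N 1 = Q\<^sup>2 + Q \<and> N g = Q\<^sup>2 - Q \<or> N 1 = Q\<^sup>2 - Q \<and> N g = Q\<^sup>2 + Q"
proof -
  define h where "h = int ((CARD('k) - 1) div 2)"
  define q where "q = int CARD('k)"
  define b where "b = int Q"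
  define d where "d = int (N 1) - b\<^sup>2"
  have h: "2 * h = q - 1"
    using arg_cong[OF sum_N_nonzero(2), of int] card_k_gt_1 unfolding h_def q_def by linarith
  have "N g + N 1 = 2 * Q\<^sup>2"
    using N_add[of g] g_nonzero by simp
  then have "int (N g) + int (N 1) = 2 * b\<^sup>2"
    unfolding b_def by (metis of_nat_add of_nat_mult of_nat_numeral of_nat_power)
  then have Ns: "int (N 1) = b\<^sup>2 + d" "int (N g) = b\<^sup>2 - d"
    by (simp_all add: d_def)
  have "(\<Sum>v\<in>UNIV. (N v)\<^sup>2) = (N 0)\<^sup>2 + (\<Sum>v\<in>UNIV - {0}. (N v)\<^sup>2)"
    by (rule sum.remove) simp_all
  also have "(\<Sum>v\<in>UNIV - {0}. (N v)\<^sup>2) = (CARD('k) - 1) div 2 * ((N 1)\<^sup>2 + (N g)\<^sup>2)"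
    using sum_N_nonzero(1)[of "\<lambda>n. n\<^sup>2"] by simp
  finally have "CARD('k) * ((Q\<^sup>2)\<^sup>2 + (CARD('k) - 1) div 2 * ((N 1)\<^sup>2 + (N g)\<^sup>2)) =
      CARD('k) * (CARD('k) * Q\<^sup>2) + (CARD('k) * Q\<^sup>2 - 1) * (CARD('k) * Q\<^sup>2)"
    using sum_N_square by (simp only: card_field N_0)
  then have "int (CARD('k) * ((Q\<^sup>2)\<^sup>2 + (CARD('k) - 1) div 2 * ((N 1)\<^sup>2 + (N g)\<^sup>2))) =
      int (CARD('k) * (CARD('k) * Q\<^sup>2) + (CARD('k) * Q\<^sup>2 - 1) * (CARD('k) * Q\<^sup>2))"
    by (rule arg_cong)
  moreover have "int (CARD('k) * Q\<^sup>2 - 1) = q * b\<^sup>2 - 1"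
    using Q_pos card_k_gt_1 by (simp add: q_def b_def)
  ultimately have "q * ((b\<^sup>2)\<^sup>2 + h * ((b\<^sup>2 + d)\<^sup>2 + (b\<^sup>2 - d)\<^sup>2))
      = q * (q * b\<^sup>2) + (q * b\<^sup>2 - 1) * (q * b\<^sup>2)"
    by (simp only: of_nat_mult of_nat_add of_nat_power Ns flip: q_def h_def b_def)
  then have "q * ((b\<^sup>2)\<^sup>2 + h * ((b\<^sup>2 + d)\<^sup>2 + (b\<^sup>2 - d)\<^sup>2))
      = q * (q * b\<^sup>2 + (q * b\<^sup>2 - 1) * b\<^sup>2)"
    by (simp add: algebra_simps)
  moreover have "q \<noteq> 0"
    by (simp add: q_def)
  ultimately have "(b\<^sup>2)\<^sup>2 + h * ((b\<^sup>2 + d)\<^sup>2 + (b\<^sup>2 - d)\<^sup>2) = q * b\<^sup>2 + (q * b\<^sup>2 - 1) * b\<^sup>2"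
    by simp
  moreover have "h * ((b\<^sup>2 + d)\<^sup>2 + (b\<^sup>2 - d)\<^sup>2) = (2 * h) * ((b\<^sup>2)\<^sup>2 + d\<^sup>2)"
    by (simp add: power2_eq_square algebra_simps)
  ultimately have "(q - 1) * d\<^sup>2 = (q - 1) * b\<^sup>2"
    unfolding h by (simp add: power2_eq_square algebra_simps)
  moreover have "q - 1 \<noteq> 0"
    using card_k_gt_1 unfolding q_def by linarith
  ultimately have "d\<^sup>2 = b\<^sup>2"
    by simp
  then have "d = b \<or> d = - b"
    by (simp add: power2_eq_iff)
  moreover have "Q \<le> Q\<^sup>2"
    by (simp add: power2_eq_square)
  then have "int (Q\<^sup>2 - Q) = b\<^sup>2 - b" "int (Q\<^sup>2 + Q) = b\<^sup>2 + b"
    by (simp_all add: b_def)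
  ultimately show ?thesis
    using Ns by (auto simp flip: of_nat_eq_iff[where 'a = int])
qed

lemma N_nonzero: "v \<noteq> 0 \<Longrightarrow> N v = Q\<^sup>2 + Q \<or> N v = Q\<^sup>2 - Q"
  using N_1_N_g N_square[of v] N_nonsquare[of v] by (cases "\<exists>z. v = z\<^sup>2") auto

section \<open>Weights of the codewords in odd degree\<close>

lemma card_field': "CARD('a) = CARD('k)\<^sup>2 * (CARD('k) * s\<^sup>2)"
  by (simp add: card_field Q_eq power2_eq_square)

lemma M_of_N_plus:
  assumes "T (a\<^sup>2) \<noteq> 0" and "N (T (a\<^sup>2)) = Q\<^sup>2 + Q"
  shows "M 0 a 1 = CARD('k) * s\<^sup>2 - s" and "M 0 a 0 = CARD('k) * s\<^sup>2 + (CARD('k) - 1) * s"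
proof -
  define q b c where "q = int CARD('k)" and "b = int Q" and "c = int s"
  have b: "b = q * c"
    by (simp add: b_def q_def c_def Q_eq)
  have "int (N (T (a\<^sup>2))) * int (M 0 a 1) = (b\<^sup>2 - 1) * (q * c\<^sup>2)"
    using int_N_mult_M[OF assms(1) card_field'] by (simp add: N_0 b_def q_def c_def)
  then have "(b * (b + 1)) * int (M 0 a 1) = (b * (b + 1)) * (q * c\<^sup>2 - c)"
    unfolding assms(2) by (simp add: b power2_eq_square algebra_simps flip: b_def)
  moreover have "b * (b + 1) \<noteq> 0"
    using Q_pos by (simp add: b_def)
  ultimately have M1: "int (M 0 a 1) = q * c\<^sup>2 - c"
    by simp
  then show "M 0 a 1 = CARD('k) * s\<^sup>2 - s"
    by (simp add: q_def c_def flip: of_nat_mult of_nat_power)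
  have "int (M 0 a 0) = b\<^sup>2 - (q - 1) * (q * c\<^sup>2 - c)"
    using int_M_0[of a] by (simp only: N_0 M1 q_def b_def of_nat_power)
  also have "\<dots> = q * c\<^sup>2 + (q - 1) * c"
    by (simp add: b power2_eq_square algebra_simps)
  also have "\<dots> = int (CARD('k) * s\<^sup>2 + (CARD('k) - 1) * s)"
    using card_k_gt_1 by (simp add: q_def c_def)
  finally show "M 0 a 0 = CARD('k) * s\<^sup>2 + (CARD('k) - 1) * s"
    by (simp only: of_nat_eq_iff)
qed

lemma M_of_N_minus:
  assumes "T (a\<^sup>2) \<noteq> 0" and "N (T (a\<^sup>2)) = Q\<^sup>2 - Q"
  shows "M 0 a 1 = CARD('k) * s\<^sup>2 + s" and "M 0 a 0 = CARD('k) * s\<^sup>2 - (CARD('k) - 1) * s"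
proof -
  define q b c where "q = int CARD('k)" and "b = int Q" and "c = int s"
  have b: "b = q * c"
    by (simp add: b_def q_def c_def Q_eq)
  have "Q \<le> Q\<^sup>2"
    by (simp add: power2_eq_square)
  then have "int (N (T (a\<^sup>2))) = b\<^sup>2 - b"
    by (simp add: assms(2) b_def)
  then have N: "int (N (T (a\<^sup>2))) = b * (b - 1)"
    by (simp only: power2_eq_square[of b] right_diff_distrib mult_1_right)
  have "int (N (T (a\<^sup>2))) * int (M 0 a 1) = (b\<^sup>2 - 1) * (q * c\<^sup>2)"
    using int_N_mult_M[OF assms(1) card_field'] by (simp add: N_0 b_def q_def c_def)
  then have "(b * (b - 1)) * int (M 0 a 1) = (b * (b - 1)) * (q * c\<^sup>2 + c)"
    unfolding N by (simp add: b power2_eq_square algebra_simps)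
  \<comment> \<open>The product is \<open>N (T (a\<^sup>2))\<close>, which counts \<open>a\<close>
    itself.\<close>
  moreover have "b * (b - 1) \<noteq> 0"
    using N_T_square_pos[of a] N by linarith
  ultimately have M1: "int (M 0 a 1) = q * c\<^sup>2 + c"
    by simp
  then show "M 0 a 1 = CARD('k) * s\<^sup>2 + s"
    by (simp add: q_def c_def flip: of_nat_mult of_nat_power of_nat_add)
  have "int (M 0 a 0) = b\<^sup>2 - (q - 1) * (q * c\<^sup>2 + c)"
    using int_M_0[of a] by (simp only: N_0 M1 q_def b_def of_nat_power)
  also have "\<dots> = q * c\<^sup>2 - (q - 1) * c"
    by (simp add: b power2_eq_square algebra_simps)
  finally have M0: "int (M 0 a 0) = q * c\<^sup>2 - (q - 1) * c" .
  \<comment> \<open>With the subtracted term on the left, the passage to natural numbers involves no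
    truncation.\<close>
  then have "int (M 0 a 0 + (CARD('k) - 1) * s) = int (CARD('k) * s\<^sup>2)"
    using card_k_gt_1 by (simp add: q_def c_def)
  then have "M 0 a 0 + (CARD('k) - 1) * s = CARD('k) * s\<^sup>2"
    by (simp only: of_nat_eq_iff)
  then show "M 0 a 0 = CARD('k) * s\<^sup>2 - (CARD('k) - 1) * s"
    by simp
qed

lemma M_isotropic_odd:
  assumes "a \<noteq> 0" and "T (a\<^sup>2) = 0"
  shows "M 0 a 1 = CARD('k) * s\<^sup>2" and "M 0 a 0 = CARD('k) * s\<^sup>2"
proof -
  define q c where "q = int CARD('k)" and "c = int s"
  show M1: "M 0 a 1 = CARD('k) * s\<^sup>2"
    using M_isotropic_eq[OF card_field' assms] .
  have "int (M 0 a 0) = (q * c)\<^sup>2 - (q - 1) * (q * c\<^sup>2)"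
    using int_M_0[of a] by (simp add: M1 N_0 Q_eq q_def c_def)
  also have "\<dots> = q * c\<^sup>2"
    by (simp add: power2_eq_square algebra_simps)
  also have "\<dots> = int (CARD('k) * s\<^sup>2)"
    by (simp add: q_def c_def)
  finally show "M 0 a 0 = CARD('k) * s\<^sup>2"
    by (simp only: of_nat_eq_iff)
qed

lemma sum_M_odd:
  fixes F :: "nat \<Rightarrow> nat \<Rightarrow> 'c::comm_ring_1"
  shows "(\<Sum>a\<in>UNIV. F (M 0 a 0) (M 0 a 1)) = F (Q\<^sup>2) 0
    + of_nat (Q\<^sup>2 - 1) * F (CARD('k) * s\<^sup>2) (CARD('k) * s\<^sup>2)
    + of_nat ((CARD('k) - 1) div 2 * (Q\<^sup>2 + Q))
        * F (CARD('k) * s\<^sup>2 + (CARD('k) - 1) * s) (CARD('k) * s\<^sup>2 - s)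
    + of_nat ((CARD('k) - 1) div 2 * (Q\<^sup>2 - Q))
        * F (CARD('k) * s\<^sup>2 - (CARD('k) - 1) * s) (CARD('k) * s\<^sup>2 + s)"
proof -
  let ?A = "F (CARD('k) * s\<^sup>2) (CARD('k) * s\<^sup>2)"
    and ?B = "F (CARD('k) * s\<^sup>2 + (CARD('k) - 1) * s) (CARD('k) * s\<^sup>2 - s)"
    and ?C = "F (CARD('k) * s\<^sup>2 - (CARD('k) - 1) * s) (CARD('k) * s\<^sup>2 + s)"
  \<comment> \<open>The term of an anisotropic \<open>a\<close> depends only on \<open>N v\<close>;
    expressed through \<open>G\<close>, the sum over \<open>v\<close> falls under
    \<open>sum_N_nonzero\<close>.\<close>
  define G where "G n = (if n = Q\<^sup>2 + Q then ?B else ?C)" for n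
  have "Q\<^sup>2 - Q \<noteq> Q\<^sup>2 + Q"
    using Q_pos by linarith
  then have G: "G (Q\<^sup>2 + Q) = ?B" "G (Q\<^sup>2 - Q) = ?C"
    by (simp_all only: G_def simp_thms if_True if_False)
  have "(\<Sum>a\<in>{a. T (a\<^sup>2) = 0} - {0}. F (M 0 a 0) (M 0 a 1)) = (\<Sum>a\<in>{a. T (a\<^sup>2) = 0} - {0}. ?A)"
    by (rule sum.cong[OF refl]) (simp add: M_isotropic_odd)
  also have "\<dots> = of_nat (N 0 - 1) * ?A"
    by (simp add: N_def T_0)
  finally have A: "(\<Sum>a\<in>{a. T (a\<^sup>2) = 0} - {0}. F (M 0 a 0) (M 0 a 1)) = of_nat (Q\<^sup>2 - 1) * ?A"
    by (simp only: N_0)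
  have "(\<Sum>v\<in>UNIV - {0}. \<Sum>a | T (a\<^sup>2) = v. F (M 0 a 0) (M 0 a 1))
      = (\<Sum>v\<in>UNIV - {0}. \<Sum>a | T (a\<^sup>2) = v. G (N v))"
  proof (intro sum.cong refl)
    fix v a assume "v \<in> UNIV - {0}" "a \<in> {a. T (a\<^sup>2) = v}"
    then have v: "T (a\<^sup>2) \<noteq> 0" "v = T (a\<^sup>2)"
      by auto
    show "F (M 0 a 0) (M 0 a 1) = G (N v)"
      using N_nonzero[OF v(1)] M_of_N_plus[OF v(1)] M_of_N_minus[OF v(1)] G unfolding v(2) by auto
  qed
  also have "\<dots> = (\<Sum>v\<in>UNIV - {0}. of_nat (N v) * G (N v))"
    by (simp add: N_def)
  also have "\<dots> = of_nat ((CARD('k) - 1) div 2) * (of_nat (N 1) * G (N 1) + of_nat (N g) * G (N g))"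
    by (rule sum_N_nonzero(1))
  \<comment> \<open>Either assignment of the two values to \<open>N 1\<close> and \<open>N g\<close>
    gives the same sum.\<close>
  also have "\<dots> = of_nat ((CARD('k) - 1) div 2) * (of_nat (Q\<^sup>2 + Q) * ?B + of_nat (Q\<^sup>2 - Q) * ?C)"
    using N_1_N_g by (elim disjE conjE) (simp_all only: G, simp only: add.commute)
  finally have B: "(\<Sum>v\<in>UNIV - {0}. \<Sum>a | T (a\<^sup>2) = v. F (M 0 a 0) (M 0 a 1)) = \<dots>" .
  show ?thesis
    by (simp only: sum_by_T_square[of "\<lambda>a. F (M 0 a 0) (M 0 a 1)"] M_0_eq A B N_0,
        simp only: of_nat_mult, simp only: distrib_left mult.assoc add.assoc)
qed

end

section \<open>Linear codes\<close>

text \<open>A finite carrier spans itself, so a finite basis exists; coordinates identify vectors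
  with functions from the basis to the scalars.\<close>

lemma (in vectorspace) card_carrier_eq:
  assumes "finite (carrier V)"
  shows "card (carrier V) = card (carrier K) ^ dim"
proof -
  have "gen_set (carrier V)"
    using in_own_span[of "carrier V"] span_closed[of "carrier V"] by auto
  then have fin_dim
    using assms unfolding fin_dim_def by blast
  then obtain B where B: "finite B" "basis B"
    using finite_basis_exists by blast
  then have BV: "B \<subseteq> carrier V"
    by (simp add: basis_def)
  have ex1: "\<exists>!a. a \<in> B \<rightarrow>\<^sub>E carrier K \<and> lincomb a B = v" if "v \<in> carrier V" for v
    using basis_criterion[OF B(1) BV] B(2) that by blast
  have "bij_betw (\<lambda>a. lincomb a B) (B \<rightarrow>\<^sub>E carrier K) (carrier V)"
  proof (rule bij_betwI')
    have closed: "lincomb a B \<in> carrier V" if "a \<in> B \<rightarrow>\<^sub>E carrier K" for a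
      using BV that by (intro lincomb_closed) auto
    then show "lincomb a B \<in> carrier V" if "a \<in> B \<rightarrow>\<^sub>E carrier K" for a
      using that .
    show "lincomb a B = lincomb b B \<longleftrightarrow> a = b"
      if "a \<in> B \<rightarrow>\<^sub>E carrier K" "b \<in> B \<rightarrow>\<^sub>E carrier K" for a b
      using that ex1[OF closed[OF that(1)]] by metis
    show "\<exists>a\<in>B \<rightarrow>\<^sub>E carrier K. v = lincomb a B" if "v \<in> carrier V" for v
      using ex1[OF that] by metis
  qed
  then have "card (carrier V) = card (B \<rightarrow>\<^sub>E carrier K)"
    by (simp add: bij_betw_same_card)
  also have "\<dots> = card (carrier K) ^ card B"
    using B(1) by (simp add: card_PiE)
  finally show ?thesis
    using dim_basis[OF B] by simp
qed

text \<open>The dimension is read off from the cardinality, so no basis of the code has to be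
  exhibited.\<close>

lemma linear_codeI:
  fixes C :: "'k::{field,finite} vec set"
  assumes carrier: "C \<subseteq> carrier_vec n" and zero: "0\<^sub>v n \<in> C"
    and add: "\<And>u v. u \<in> C \<Longrightarrow> v \<in> C \<Longrightarrow> u + v \<in> C"
    and smult: "\<And>c v. v \<in> C \<Longrightarrow> c \<cdot>\<^sub>v v \<in> C"
    and card: "card C = CARD('k) ^ m"
  shows "linear_code n m C"
proof -
  interpret V: vec_space "TYPE('k)" n .
  have sub: "subspace class_ring C (module_vec TYPE('k) n)"
    unfolding subspace_def
  proof
    show "submodule class_ring C (module_vec TYPE('k) n)"
      by unfold_locales (use assms in \<open>auto simp: module_vec_simps class_ring_simps\<close>)
  qed (rule vec_vs)
  then have "vectorspace class_ring (module_vec TYPE('k) n\<lparr>carrier := C\<rparr>)"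
    by (rule V.subspace_is_vs)
  then interpret C: vectorspace "class_ring :: 'k ring" "module_vec TYPE('k) n\<lparr>carrier := C\<rparr>" .
  have "finite C"
    using card by (intro card_ge_0_finite) simp
  then have "CARD('k) ^ m = CARD('k) ^ C.dim"
    using C.card_carrier_eq card by (simp add: class_ring_simps)
  moreover have "CARD('k) > 1"
    by (rule card_finite_field_gt_1)
    ultimately have "C.dim = m"
    by simp
  then show ?thesis
    unfolding linear_code_def using sub by blast
qed

section \<open>The trace to the prime field\<close>

lemma to_int_mod_ring_add:
  "to_int_mod_ring (c + d :: 'p::nontriv mod_ring)
    = (to_int_mod_ring c + to_int_mod_ring d) mod int CARD('p)"
  by transfer simp

lemma to_int_mod_ring_mult:
  "to_int_mod_ring (c * d :: 'p::nontriv mod_ring)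
    = (to_int_mod_ring c * to_int_mod_ring d) mod int CARD('p)"
  by transfer simp

definition embed :: "'p::prime_card mod_ring \<Rightarrow> 'a::field" where
  "embed t = of_int (to_int_mod_ring t)"

lemma of_int_mod_CHAR:
  assumes "CHAR('a::field) = p"
  shows "(of_int (k mod int p) :: 'a) = of_int k"
proof -
  have "of_int k = (of_int (k div int p * int p + k mod int p) :: 'a)"
    by simp
  also have "\<dots> = of_int (k mod int p)"
    by (simp only: of_int_add of_int_mult of_int_of_nat_eq flip: assms) simp
  finally show ?thesis by simp
qed

locale finite_field_extension =
  fixes emb :: "'p::prime_card mod_ring \<Rightarrow> 'a::{field,finite}" and m :: nat
  assumes emb_def: "emb = embed"
    and card_field: "CARD('a) = CARD('p) ^ m"
    and m_pos: "m > 0"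
begin

lemma CHAR_eq: "CHAR('a) = CARD('p)"
proof -
  have prime: "prime CHAR('a)"
    by (rule prime_CHAR_semidom) (simp add: finite_imp_CHAR_pos)
  then have "CHAR('a) dvd CARD('p)"
    using CHAR_dvd_CARD[where 'a = 'a] card_field by (metis prime_dvd_power)
  then show ?thesis
    using prime prime_card[where 'a = 'p] by (simp add: primes_dvd_imp_eq)
qed

lemma prime_CHAR: "prime CHAR('a)"
  using prime_card[where 'a = 'p] by (simp add: CHAR_eq)

lemma p_gt_1: "CARD('p) > 1"
  using prime_card[where 'a = 'p] by (rule prime_gt_1_nat)

lemma emb_add: "emb (c + d) = emb c + emb d"
  by (simp add: emb_def embed_def to_int_mod_ring_add of_int_mod_CHAR[OF CHAR_eq])

lemma emb_mult: "emb (c * d) = emb c * emb d"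
  by (simp add: emb_def embed_def to_int_mod_ring_mult of_int_mod_CHAR[OF CHAR_eq])

lemma emb_1: "emb 1 = 1"
  by (simp add: emb_def embed_def one_mod_ring.rep_eq to_int_mod_ring.rep_eq)

sublocale field_embedding emb
  by (rule field_embedding.intro) (fact emb_add emb_mult emb_1)+

lemma mod_ring_power_p: "c ^ CARD('p) = (c :: 'p mod_ring)"
  using finite_field_power_card_eq_same[of c] by simp

lemma emb_power_p: "emb c ^ CARD('p) = emb c"
  by (simp only: mod_ring_power_p flip: emb_power)

lemma emb_power_p_power: "emb c ^ (CARD('p) ^ i) = emb c"
  by (induction i) (simp_all add: power_mult emb_power_p)

lemma frob_add: "(x + y :: 'a) ^ (CARD('p) ^ i) = x ^ (CARD('p) ^ i) + y ^ (CARD('p) ^ i)"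
  by (rule freshmans_dream'[OF prime_CHAR]) (simp add: CHAR_eq)

text \<open>The prime field is the fixed set of Frobenius: it is contained in that set, and both
  have p elements.\<close>

lemma range_emb: "range emb = {y. y ^ CARD('p) = y}"
proof (rule card_subset_eq)
  show "range emb \<subseteq> {y. y ^ CARD('p) = y}"
    by (auto simp: emb_power_p)
  have "card (range emb) = CARD('p)"
    using emb_inj by (simp add: card_image)
  then show "card (range emb) = card {y::'a. y ^ CARD('p) = y}"
    using card_power_eq_self[OF card_field] by simp
qed simp

section \<open>The trace as a sum of conjugates\<close>

definition S :: "'a \<Rightarrow> 'a" where
  "S x = (\<Sum>i<m. x ^ (CARD('p) ^ i))"

abbreviation T :: "'a \<Rightarrow> 'p mod_ring" where
  "T \<equiv> field_trace m"

lemma power_p_m: "(x::'a) ^ (CARD('p) ^ m) = x"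
  using finite_field_power_card[of x] by (simp only: card_field)

lemma S_shift: "S (x ^ CARD('p)) = S x"
proof -
  have "S (x ^ CARD('p)) = (\<Sum>i<m. x ^ (CARD('p) ^ Suc i))"
    by (simp add: S_def flip: power_mult)
  also have "\<dots> = (\<Sum>i<Suc m. x ^ (CARD('p) ^ i)) - x"
    by (subst sum.lessThan_Suc_shift) simp
  also have "\<dots> = S x"
    by (simp add: S_def power_p_m)
  finally show ?thesis .
qed

lemma S_power: "S x ^ CARD('p) = S x"
proof -
  have "S x ^ CARD('p) = (\<Sum>i<m. (x ^ (CARD('p) ^ i)) ^ CARD('p))"
    unfolding S_def by (rule freshmans_dream_sum[OF prime_CHAR]) (simp add: CHAR_eq)
  also have "\<dots> = S (x ^ CARD('p))"
    by (simp add: S_def mult.commute flip: power_mult)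
  finally show ?thesis
    by (simp add: S_shift)
qed

text \<open>The description in \<open>field_trace\<close> is well defined: \<open>S x\<close> is
  fixed by Frobenius, hence in the range of \<open>emb\<close>, and \<open>emb\<close> is
  injective.\<close>

lemma emb_T: "emb (T x) = S x"
proof -
  have "S x \<in> range emb"
    using S_power by (simp add: range_emb)
  then obtain t where t: "S x = emb t" by blast
  have "T x = (THE t. emb t = S x)"
    by (simp add: field_trace_def S_def emb_def embed_def)
  also have "\<dots> = t"
    using emb_inj t by (intro the_equality) (auto dest: injD)
  finally show ?thesis
    using t by simp
qed

lemma T_eqI: "S x = emb c \<Longrightarrow> T x = c"
  using emb_T emb_inj by (metis injD)

lemma T_add: "T (x + y) = T x + T y"
  by (rule T_eqI) (simp add: emb_add emb_T, simp add: S_def frob_add sum.distrib)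

lemma T_smult: "T (emb c * x) = c * T x"
  by (rule T_eqI)
    (simp add: emb_mult emb_T, simp add: S_def power_mult_distrib emb_power_p_power sum_distrib_left)

lemma T_frob: "T (x ^ (CARD('p) ^ i)) = T x"
proof (induction i)
  case (Suc i)
  have "T (x ^ (CARD('p) ^ Suc i)) = T ((x ^ (CARD('p) ^ i)) ^ CARD('p))"
    by (simp add: mult.commute flip: power_mult)
  also have "\<dots> = T (x ^ (CARD('p) ^ i))"
    by (rule T_eqI) (simp add: emb_T S_shift)
  finally show ?case
    using Suc by simp
qed simp

text \<open>The trace polynomial \<open>?f\<close> is nonzero, its linear coefficient being 1, and
  its degree is at most p^(m-1), so it cannot vanish at all p^m elements.\<close>

lemma T_nonzero: "\<exists>x. T x \<noteq> 0"
proof (rule ccontr)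
  assume "\<nexists>x. T x \<noteq> 0"
  then have S0: "S x = 0" for x
    by (metis emb_0 emb_T)
  let ?f = "\<Sum>i<m. monom 1 (CARD('p) ^ i) :: 'a poly"
  have "coeff ?f 1 = (\<Sum>i<m. if i = 0 then 1 else 0)"
    unfolding coeff_sum using p_gt_1 by (intro sum.cong refl) auto
  also have "\<dots> = 1"
    using m_pos by simp
  finally have "?f \<noteq> 0"
    by (metis coeff_0 zero_neq_one)
  then have "card {x. poly ?f x = 0} \<le> degree ?f"
    by (rule card_poly_roots_bound)
  moreover have "degree ?f \<le> CARD('p) ^ (m - 1)"
    using p_gt_1
    by (intro degree_sum_le) (auto intro!: order.trans[OF degree_monom_le] power_increasing)
  moreover have "{x. poly ?f x = 0} = UNIV"
    using S0 by (auto simp: poly_sum poly_monom S_def)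
  ultimately have "CARD('p) ^ m \<le> CARD('p) ^ (m - 1)"
    by (simp add: card_field)
  then show False
    using p_gt_1 m_pos by simp
qed

lemma two_nonzero:
  assumes "odd CARD('p)"
  shows "(2 :: 'p mod_ring) \<noteq> 0"
proof
  assume "(2 :: 'p mod_ring) = 0"
  then have "CARD('p) dvd 2"
    using of_nat_0_mod_ring_dvd[where 'a = 'p, of 2] by simp
  then show False
    using assms p_gt_1 dvd_imp_le[of "CARD('p)" 2] by (cases "CARD('p) = 2") auto
qed

lemma quadratic_trace: "odd CARD('p) \<Longrightarrow> quadratic_trace emb T"
  by (intro quadratic_trace.intro quadratic_trace_axioms.intro field_embedding_axioms
    T_add T_smult T_nonzero two_nonzero)

text \<open>A nonsquare \<open>g\<close> of the prime field has \<open>?h\<close>-th power -1. The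
  exponent of Euler's criterion in the extension is \<open>?h\<close> times a sum of
  \<open>m\<close> odd terms, which is odd, so that power of \<open>emb g\<close> is again
  -1.\<close>

lemma nonsquare_exists:
  assumes "odd CARD('p)" and "odd m"
  shows "\<exists>g. \<nexists>z. emb g = z\<^sup>2"
proof -
  let ?h = "(CARD('p) - 1) div 2"
  note two = two_nonzero[OF assms(1)]
  interpret quadratic_trace emb T
    using assms(1) by (rule quadratic_trace)
  have "\<exists>g::'p mod_ring. g \<noteq> 0 \<and> (\<nexists>z. g = z\<^sup>2)"
  proof (rule ccontr)
    assume "\<not> ?thesis"
    then have "{y::'p mod_ring. y \<noteq> 0 \<and> (\<exists>x. y = x\<^sup>2)} = UNIV - {0}"
      by auto
    then show False
      using card_nonzero_squares[OF two] p_gt_1 by simp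
  qed
  then obtain g :: "'p mod_ring" where g: "g \<noteq> 0" "\<nexists>z. g = z\<^sup>2"
    by blast
  have h: "CARD('p) - 1 = ?h * 2"
    using assms(1) by simp
  have "(g ^ ?h)\<^sup>2 = g ^ (?h * 2)"
    by (simp only: power_mult)
  also have "\<dots> = 1"
    using finite_field_power_card_minus_1[OF g(1)] h by simp
  finally have "g ^ ?h = - 1"
    using square_iff_power_eq_1[OF two g(1)] g(2) by (auto simp: power2_eq_1_iff)
  then have gh: "emb g ^ ?h = - 1"
    by (metis emb_power emb_minus emb_1)
  have "int (CARD('p) ^ m - 1) = (int CARD('p) - 1) * (\<Sum>i<m. int CARD('p) ^ i)"
    using p_gt_1 by (simp add: power_diff_1_eq)
  also have "int CARD('p) - 1 = int (CARD('p) - 1)"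
    using p_gt_1 by simp
  also have "\<dots> = int (?h * 2)"
    using h by (rule arg_cong)
  also have "int (?h * 2) * (\<Sum>i<m. int CARD('p) ^ i) = int (2 * (?h * (\<Sum>i<m. CARD('p) ^ i)))"
    by simp
  finally have "CARD('p) ^ m - 1 = 2 * (?h * (\<Sum>i<m. CARD('p) ^ i))"
    by (simp only: of_nat_eq_iff)
  then have e: "(CARD('a) - 1) div 2 = ?h * (\<Sum>i<m. CARD('p) ^ i)"
    by (simp add: card_field)
  have "odd (\<Sum>i<k. CARD('p) ^ i) \<longleftrightarrow> odd k" for k
    by (induction k) (use assms(1) in auto)
  then have "emb g ^ ((CARD('a) - 1) div 2) = - 1"
    using assms(2) by (simp only: e power_mult gh) simp
  moreover have "(- 1 :: 'a) \<noteq> 1"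
    using two_nonzero' by (metis add.right_inverse one_add_one)
  ultimately have "\<nexists>z. emb g = z\<^sup>2"
    using square_iff_power_eq_1[OF two_nonzero' emb_nonzero[OF g(1)]] by simp
  then show ?thesis by blast
qed

end

section \<open>The code\<close>

text \<open>Identifies \<epsilon> with \<open>sg\<close>: both are -1 exactly when \<open>k\<close>
  is odd and \<open>p\<close> is 3 modulo 4.\<close>

lemma minus_one_power_eq_mod_4:
  assumes "odd p"
  shows "(- 1 :: int) ^ (k * ((p - 1) div 2)\<^sup>2) = (if p ^ k mod 4 = 3 then - 1 else 1)"
proof (cases "p mod 4 = 3")
  case True
  then have "odd ((p - 1) div 2)"
    by presburger
  moreover have "p ^ k mod 4 = (if even k then 1 else 3)"
  proof (induction k)
    case (Suc k)
    have "p ^ Suc k mod 4 = (p mod 4) * (p ^ k mod 4) mod 4"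
      by (simp add: mod_mult_eq)
    then show ?case
      using Suc True by simp
  qed simp
  ultimately show ?thesis
    by simp
next
  case False
  then have p: "p mod 4 = 1" and "even ((p - 1) div 2)"
    using assms by presburger+
  moreover have "p ^ k mod 4 = 1"
    using p by (metis power_mod power_one mod_less one_less_numeral_iff semiring_norm(76))
  ultimately show ?thesis
    by simp
qed

locale trace_code = finite_field_extension emb m
  for emb :: "'p::prime_card mod_ring \<Rightarrow> 'a::{field,finite}" and m +
  fixes ds :: "'a list"
  assumes odd_p: "odd CARD('p)"
    and set_ds: "set ds = {x. x \<noteq> 0 \<and> field_trace m (x\<^sup>2) = (0 :: 'p mod_ring)}"
    and distinct_ds: "distinct ds"
begin

sublocale qt: quadratic_trace emb T
  using odd_p by (rule quadratic_trace)

definition codeword :: "'a \<Rightarrow> 'p mod_ring vec" where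
  "codeword a = vec (length ds) (\<lambda>i. T (a * ds ! i))"

lemma length_ds: "length ds = qt.N 0 - 1"
proof -
  have "set ds = {x. T (x\<^sup>2) = 0} - {0}"
    by (auto simp: set_ds)
  then have "card (set ds) = qt.N 0 - 1"
    by (simp add: qt.N_def qt.T_0)
  then show ?thesis
    by (simp add: distinct_card distinct_ds)
qed

text \<open>Positions correspond to nonzero \<open>x\<close>, while \<open>M\<close> also counts
  \<open>x = 0\<close> when \<open>c = 0\<close>.\<close>

lemma card_coordinates:
  "card {i. i < length ds \<and> T (a * ds ! i) = c} = qt.M 0 a c - (if c = 0 then 1 else 0)"
proof -
  let ?I = "{i. i < length ds \<and> T (a * ds ! i) = c}"
  have "card ?I = card ((!) ds ` ?I)"
    using distinct_ds by (intro card_image[symmetric] inj_onI) (auto simp: nth_eq_iff_index_eq)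
  also have "(!) ds ` ?I = {x \<in> set ds. T (a * x) = c}"
    by (auto simp: in_set_conv_nth)
  also have "\<dots> = {x. T (x\<^sup>2) = 0 \<and> T (a * x) = c} - {0}"
    by (auto simp: set_ds)
  also have "card \<dots> = qt.M 0 a c - (if c = 0 then 1 else 0)"
    by (simp add: qt.M_def card_Diff_singleton_if qt.T_0)
  finally show ?thesis .
qed

text \<open>The argument \<open>i\<close> also counts \<open>x = 0\<close>, which is not a coordinate; hence \<open>i - 1\<close>.\<close>

definition word_monomial :: "nat \<Rightarrow> nat \<Rightarrow> int_mpoly" where
  "word_monomial i j = W 0 ^ (i - 1) * (\<Prod>\<rho>=1..CARD('p) - 1. W \<rho> ^ j)"

text \<open>By \<open>M_smult\<close> every nonzero symbol occurs as often as 1.\<close>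

lemma weight_monomial_codeword:
  "weight_monomial (codeword a) = word_monomial (qt.M 0 a 0) (qt.M 0 a 1)"
proof -
  have coords: "{i. i < dim_vec (codeword a) \<and> codeword a $ i = c}
      = {i. i < length ds \<and> T (a * ds ! i) = c}" for c
    by (auto simp: codeword_def)
  have M: "qt.M 0 a (of_nat j) - (if (of_nat j :: 'p mod_ring) = 0 then 1 else 0) = qt.M 0 a 1"
    if "j \<in> {1..CARD('p) - 1}" for j
  proof -
    have "\<not> CARD('p) dvd j"
      using that by (auto dest: dvd_imp_le)
    then have "(of_nat j :: 'p mod_ring) \<noteq> 0"
      using of_nat_0_mod_ring_dvd by blast
    then show ?thesis
      using qt.M_smult[of "of_nat j" a 1] by simp
  qed
  have "{..<CARD('p)} = insert 0 {1..CARD('p) - 1}"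
    using p_gt_1 by auto
  then have "weight_monomial (codeword a) = W 0 ^ (qt.M 0 a 0 - 1) *
      (\<Prod>j=1..CARD('p) - 1. W j ^ (qt.M 0 a (of_nat j) - (if (of_nat j :: 'p mod_ring) = 0 then 1 else 0)))"
    unfolding weight_monomial_def coords card_coordinates by simp
  also have "(\<Prod>j=1..CARD('p) - 1. W j ^ (qt.M 0 a (of_nat j) - (if (of_nat j :: 'p mod_ring) = 0 then 1 else 0)))
      = (\<Prod>j=1..CARD('p) - 1. W j ^ qt.M 0 a 1)"
    by (intro prod.cong refl arg_cong2[where f = "(^)"] M)
  finally show ?thesis
    by (simp only: word_monomial_def)
qed

section \<open>Linearity and injectivity of the encoding\<close>

lemma codeword_add: "codeword (a + b) = codeword a + codeword b"
  by (rule eq_vecI) (simp_all add: codeword_def distrib_right T_add)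

lemma codeword_smult: "codeword (emb c * a) = c \<cdot>\<^sub>v codeword a"
  by (rule eq_vecI) (simp_all add: codeword_def mult.assoc T_smult)

text \<open>For isotropic \<open>a\<close> the count follows from \<open>M_isotropic\<close>;
  otherwise the right-hand side of \<open>N_mult_M\<close> is positive because
  \<open>N 0 - 1\<close> is the length of the code.\<close>

lemma M_1_pos:
  assumes "ds \<noteq> []" and "a \<noteq> 0"
  shows "qt.M 0 a 1 > 0"
proof (cases "T (a\<^sup>2) = 0")
  case True
  then have "CARD('p mod_ring) * (CARD('p mod_ring) * qt.M 0 a 1) = CARD('a)"
    using qt.M_isotropic[of a 1 0] qt.card_T_mult_eq[OF assms(2), of 1] by simp
  then show ?thesis
    by (intro gr0I) simp
next
  case False
  have "length ds > 0"
    using assms(1) by simp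
  then have "qt.N 0 - 1 > 0"
    by (simp only: length_ds)
  then show ?thesis
    using qt.N_mult_M[OF False, of 1] by (intro gr0I) simp
qed

text \<open>Distinct \<open>a\<close> and \<open>b\<close> are told apart at a coordinate
  \<open>x\<close> with \<open>T ((a - b) * x) = 1\<close>. Hence the code has p^m words, and its
  enumerator can be summed over \<open>a\<close>.\<close>

lemma codeword_inj:
  assumes "ds \<noteq> []"
  shows "inj codeword"
proof (rule injI, rule ccontr)
  fix a b assume eq: "codeword a = codeword b" and "a \<noteq> b"
  then have "qt.M 0 (a - b) 1 > 0"
    using M_1_pos[OF assms, of "a - b"] by simp
  then obtain x where x: "T (x\<^sup>2) = 0" "T ((a - b) * x) = 1"
    by (auto simp: qt.M_def card_gt_0_iff)
  then have "x \<noteq> 0"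
    using qt.T_0 by auto
  then have "x \<in> set ds"
    using x(1) by (simp add: set_ds)
  then obtain i where i: "i < length ds" "x = ds ! i"
    by (auto simp: in_set_conv_nth)
  have "codeword a $ i = codeword b $ i"
    by (simp only: eq)
  then have "T ((a - b) * x) = 0"
    using i by (simp add: codeword_def left_diff_distrib qt.T_diff)
  then show False
    using x(2) by simp
qed

lemma linear_code_range:
  assumes "ds \<noteq> []"
  shows "linear_code (length ds) m (range codeword)"
proof (rule linear_codeI)
  show "range codeword \<subseteq> carrier_vec (length ds)"
    by (auto simp: codeword_def)
  have "codeword 0 = 0\<^sub>v (length ds)"
    by (rule eq_vecI) (simp_all add: codeword_def qt.T_0)
  then show "0\<^sub>v (length ds) \<in> range codeword"
    by (metis rangeI)
  show "u + v \<in> range codeword" if "u \<in> range codeword" "v \<in> range codeword" for u v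
    using that by (auto simp flip: codeword_add)
  show "c \<cdot>\<^sub>v v \<in> range codeword" if "v \<in> range codeword" for c v
    using that by (auto simp flip: codeword_smult)
  show "card (range codeword) = CARD('p mod_ring) ^ m"
    using codeword_inj[OF assms] by (simp add: card_image card_field)
qed

lemma CWE_range:
  assumes "ds \<noteq> []"
  shows "CWE (range codeword) = (\<Sum>a\<in>UNIV. word_monomial (qt.M 0 a 0) (qt.M 0 a 1))"
  unfolding CWE_def using codeword_inj[OF assms]
  by (simp add: sum.reindex weight_monomial_codeword)

section \<open>The enumerators for the two parities of \<open>m\<close>\<close>

lemma odd_case:
  assumes "odd m" and "m \<ge> 3"
  defines "p \<equiv> CARD('p)"
  shows "length ds = p ^ (m - 1) - 1"
    and "linear_code (length ds) m (range codeword)"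
    and "CWE (range codeword) =
          W 0 ^ (p ^ (m - 1) - 1)
          + of_nat (p ^ (m - 1) - 1) * W 0 ^ (p ^ (m - 2) - 1)
              * (\<Prod>\<rho>=1..p - 1. W \<rho> ^ (p ^ (m - 2)))
          + of_nat ((p - 1) div 2 * (p ^ (m - 1) + p ^ ((m - 1) div 2)))
              * W 0 ^ (p ^ (m - 2) - 1 + (p - 1) * p ^ ((m - 3) div 2))
              * (\<Prod>\<rho>=1..p - 1. W \<rho> ^ (p ^ (m - 2) - p ^ ((m - 3) div 2)))
          + of_nat ((p - 1) div 2 * (p ^ (m - 1) - p ^ ((m - 1) div 2)))
              * W 0 ^ (p ^ (m - 2) - 1 - (p - 1) * p ^ ((m - 3) div 2))
              * (\<Prod>\<rho>=1..p - 1. W \<rho> ^ (p ^ (m - 2) + p ^ ((m - 3) div 2)))"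
proof -
  define s where "s = p ^ ((m - 3) div 2)"
  define Q where "Q = p ^ ((m - 1) div 2)"
  have "m = 2 * ((m - 3) div 2) + 3"
    using assms(1,2) by presburger
  then obtain k where k: "m = 2 * k + 3"
    by blast
  have sQ: "s = p ^ k" "Q = p ^ (k + 1)" and m: "m - 1 = 2 * k + 2" "m - 2 = 2 * k + 1"
    by (simp_all add: Q_def s_def k)
  have Q_eq: "Q = p * s"
    by (simp add: sQ)
  have dbl: "p ^ (k * 2) = p ^ k * p ^ k"
    by (simp add: power_mult power2_eq_square)
  have pow: "p ^ m = p * Q\<^sup>2" "p ^ (m - 1) = Q\<^sup>2" "p ^ (m - 2) = p * s\<^sup>2"
    unfolding sQ m by (simp_all add: k power_add power2_eq_square power3_eq_cube dbl mult_ac)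
  obtain g where g: "\<nexists>z. emb g = z\<^sup>2"
    using nonsquare_exists[OF odd_p assms(1)] by blast
  interpret quadratic_trace_odd emb T s Q g
    by unfold_locales (use g Q_eq in \<open>simp_all add: p_def card_field pow flip: p_def\<close>)
  have s: "s > 0"
    using p_gt_1 by (simp add: s_def p_def)
  show len: "length ds = p ^ (m - 1) - 1"
    by (simp only: length_ds N_0 pow)
  have "1 < p ^ (m - 1)"
    using p_gt_1 assms(2) by (intro one_less_power) (simp_all add: p_def)
  then have ne: "ds \<noteq> []"
    using len by auto
  then show "linear_code (length ds) m (range codeword)"
    by (rule linear_code_range)
  \<comment> \<open>Needed for \<open>plus\<close>: the 1 subtracted for \<open>x = 0\<close> comes
    off the first summand without truncation.\<close>
  have "p * s\<^sup>2 \<ge> 1"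
    using s p_gt_1 by (simp add: p_def Suc_le_eq)
  then have plus: "p * s\<^sup>2 + (p - 1) * s - 1 = p * s\<^sup>2 - 1 + (p - 1) * s"
    by simp
  have minus: "p * s\<^sup>2 - (p - 1) * s - 1 = p * s\<^sup>2 - 1 - (p - 1) * s"
    by simp
  have CARD: "CARD('p mod_ring) = p"
    by (simp add: p_def)
  show "CWE (range codeword) =
          W 0 ^ (p ^ (m - 1) - 1)
          + of_nat (p ^ (m - 1) - 1) * W 0 ^ (p ^ (m - 2) - 1)
              * (\<Prod>\<rho>=1..p - 1. W \<rho> ^ (p ^ (m - 2)))
          + of_nat ((p - 1) div 2 * (p ^ (m - 1) + p ^ ((m - 1) div 2)))
              * W 0 ^ (p ^ (m - 2) - 1 + (p - 1) * p ^ ((m - 3) div 2))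
              * (\<Prod>\<rho>=1..p - 1. W \<rho> ^ (p ^ (m - 2) - p ^ ((m - 3) div 2)))
          + of_nat ((p - 1) div 2 * (p ^ (m - 1) - p ^ ((m - 1) div 2)))
              * W 0 ^ (p ^ (m - 2) - 1 - (p - 1) * p ^ ((m - 3) div 2))
              * (\<Prod>\<rho>=1..p - 1. W \<rho> ^ (p ^ (m - 2) + p ^ ((m - 3) div 2)))"
    unfolding CWE_range[OF ne] sum_M_odd[of word_monomial] CARD pow
    unfolding word_monomial_def minus plus
    by (simp only: p_def[symmetric] s_def[symmetric] Q_def[symmetric] power_0 prod.neutral_const
        mult_1_right mult.assoc)
qed

text \<open>The length factors as \<open>(p * s + \<epsilon>) * (s - \<epsilon>)\<close>, so it is 0
  exactly when \<open>s = 1\<close> and \<open>\<epsilon> = 1\<close>, that is, for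
  \<open>m = 2\<close> and \<open>p\<close> congruent to 1 modulo 4. The only word is then the empty
  one and the encoding is not injective; hence the condition \<open>ds \<noteq> []\<close>.\<close>

lemma even_case:
  assumes "even m" and "m \<ge> 2"
  defines "p \<equiv> CARD('p)"
  defines "\<epsilon> \<equiv> (- 1 :: int) ^ ((m div 2) * ((p - 1) div 2)\<^sup>2)"
  shows "int (length ds) = int p ^ (m - 1) - 1 - \<epsilon> * (int p - 1) * int p ^ ((m - 2) div 2)"
    and "ds \<noteq> [] \<Longrightarrow> CWE (range codeword) =
            W 0 ^ nat (int p ^ (m - 1) - 1 - \<epsilon> * (int p - 1) * int p ^ ((m - 2) div 2))
            + of_int (int p ^ (m - 1) - 1 - \<epsilon> * (int p - 1) * int p ^ ((m - 2) div 2))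
                * W 0 ^ nat (int p ^ (m - 2) - 1 - \<epsilon> * (int p - 1) * int p ^ ((m - 2) div 2))
                * (\<Prod>\<rho>=1..p - 1. W \<rho> ^ (p ^ (m - 2)))
            + of_int ((int p - 1) * (int p ^ (m - 1) + \<epsilon> * int p ^ ((m - 2) div 2)))
                * W 0 ^ (p ^ (m - 2) - 1)
                * (\<Prod>\<rho>=1..p - 1.
                    W \<rho> ^ nat (int p ^ (m - 2) - \<epsilon> * int p ^ ((m - 2) div 2)))"
proof -
  define s where "s = p ^ ((m - 2) div 2)"
  define Q where "Q = p ^ (m div 2)"
  have "m = 2 * ((m - 2) div 2) + 2"
    using assms(1,2) by presburger
  then obtain k where k: "m = 2 * k + 2"
    by blast
  have sQ: "s = p ^ k" "Q = p ^ (k + 1)" and m: "m - 1 = 2 * k + 1" "m - 2 = 2 * k"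
    by (simp_all add: Q_def s_def k)
  have Q_eq: "Q = p * s"
    by (simp add: sQ)
  have dbl: "p ^ (k * 2) = p ^ k * p ^ k"
    by (simp add: power_mult power2_eq_square)
  have pow: "p ^ m = Q\<^sup>2" "p ^ (m - 1) = p * s\<^sup>2" "p ^ (m - 2) = s\<^sup>2"
    unfolding sQ m by (simp_all add: k power_add power2_eq_square dbl mult_ac)
  have ipow: "int p ^ (m - 1) = int p * (int s)\<^sup>2" "int p ^ (m - 2) = (int s)\<^sup>2"
    "int p ^ ((m - 2) div 2) = int s"
    using arg_cong[OF pow(2), of int] arg_cong[OF pow(3), of int] by (simp_all add: s_def)
  have CARD: "CARD('p mod_ring) = p"
    by (simp add: p_def)
  interpret quadratic_trace_even emb T s Q
  proof
    show "Q = CARD('p mod_ring) * s"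
      by (simp only: CARD Q_eq)
    show "CARD('a) = Q\<^sup>2"
      by (simp add: card_field flip: pow p_def)
    show "(x + y :: 'a) ^ Q = x ^ Q + y ^ Q" for x y
      unfolding Q_def p_def by (rule frob_add)
    show "emb c ^ Q = emb c" for c
      unfolding Q_def p_def by (rule emb_power_p_power)
    show "T (x ^ Q) = T x" for x
      unfolding Q_def p_def by (rule T_frob)
    show "odd Q"
      using odd_p by (simp add: Q_def p_def)
  qed
  have "odd p"
    using odd_p by (simp add: p_def)
  then have sg: "sg = \<epsilon>"
    unfolding sg_def unfolding \<epsilon>_def Q_def by (rule minus_one_power_eq_mod_4[symmetric])
  have "int (length ds) = int (qt.N 0) - 1"
    using qt.N_0_ge_1 by (simp add: length_ds)
  \<comment> \<open>Expansion of the product in \<open>int_N_0\<close>; \<open>sg * sg\<close>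
    becomes the constant 1 of the formula.\<close>
  also have "\<dots> = int p * (int s)\<^sup>2 - sg * sg - sg * (int p - 1) * int s"
    unfolding int_N_0 CARD by (simp add: power2_eq_square algebra_simps)
  finally have len: "int (length ds) = int p * (int s)\<^sup>2 - 1 - \<epsilon> * (int p - 1) * int s"
    by (simp only: sg_square) (simp add: sg)
  then show "int (length ds) = int p ^ (m - 1) - 1 - \<epsilon> * (int p - 1) * int p ^ ((m - 2) div 2)"
    by (simp only: ipow)
  assume ne: "ds \<noteq> []"
  have N0: "qt.N 0 - 1 = nat (int p * (int s)\<^sup>2 - 1 - \<epsilon> * (int p - 1) * int s)"
    by (simp only: length_ds[symmetric] len[symmetric] nat_int)
  \<comment> \<open>The argument of \<open>nat\<close> is the length of \<open>ds\<close>, hence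
    nonnegative.\<close>
  have N0': "of_nat (nat (int p * (int s)\<^sup>2 - 1 - \<epsilon> * (int p - 1) * int s))
      = (of_int (int p * (int s)\<^sup>2 - 1 - \<epsilon> * (int p - 1) * int s) :: int_mpoly)"
    by (simp only: len[symmetric] nat_int of_int_of_nat_eq)
  \<comment> \<open>Since \<open>nat z - 1 = nat (z - 1)\<close> for every integer \<open>z\<close>,
    discarding \<open>x = 0\<close> commutes with the truncation.\<close>
  have M0: "nat ((int s)\<^sup>2 - \<epsilon> * (int p - 1) * int s) - 1
      = nat ((int s)\<^sup>2 - 1 - \<epsilon> * (int p - 1) * int s)"
    by simp
  have M1: "int s * (int s - \<epsilon>) = (int s)\<^sup>2 - \<epsilon> * int s"
    by (simp add: power2_eq_square algebra_simps)
  have c: "int s * (int p * int s + \<epsilon>) = int p * (int s)\<^sup>2 + \<epsilon> * int s"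
    by (simp add: power2_eq_square algebra_simps)
  show "CWE (range codeword) =
            W 0 ^ nat (int p ^ (m - 1) - 1 - \<epsilon> * (int p - 1) * int p ^ ((m - 2) div 2))
            + of_int (int p ^ (m - 1) - 1 - \<epsilon> * (int p - 1) * int p ^ ((m - 2) div 2))
                * W 0 ^ nat (int p ^ (m - 2) - 1 - \<epsilon> * (int p - 1) * int p ^ ((m - 2) div 2))
                * (\<Prod>\<rho>=1..p - 1. W \<rho> ^ (p ^ (m - 2)))
            + of_int ((int p - 1) * (int p ^ (m - 1) + \<epsilon> * int p ^ ((m - 2) div 2)))
                * W 0 ^ (p ^ (m - 2) - 1)
                * (\<Prod>\<rho>=1..p - 1.
                    W \<rho> ^ nat (int p ^ (m - 2) - \<epsilon> * int p ^ ((m - 2) div 2)))"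
    unfolding CWE_range[OF ne] sum_M_even[of word_monomial] CARD ipow pow sg
    unfolding word_monomial_def p_def[symmetric] N0 N0' M0 M1 c
    by (simp only: power_0 prod.neutral_const mult_1_right mult.assoc)
qed

end

theorem theorem1:
  fixes p m n :: nat
    and ds :: "'a::{field,finite} list"
    and C :: "'p::prime_card mod_ring vec set"
    and \<epsilon> :: int
  assumes "p = CARD('p)" and "odd p" and "0 < m" and "CARD('a) = p ^ m"
    and "set ds = {x. x \<noteq> 0 \<and> field_trace m (x\<^sup>2) = (0 :: 'p mod_ring)}"
    and "distinct ds"
    and "n = length ds"
    and "C = {vec n (\<lambda>i. field_trace m (a * ds ! i)) | a. a \<in> UNIV}"
    and "\<epsilon> = (-1) ^ ((m div 2) * ((p - 1) div 2)\<^sup>2)"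
  shows
    "(odd m \<and> m \<ge> 3 \<longrightarrow>
        n = p ^ (m - 1) - 1 \<and>
        linear_code n m C \<and>
        CWE C =
          W 0 ^ (p ^ (m - 1) - 1)
          + of_nat (p ^ (m - 1) - 1) * W 0 ^ (p ^ (m - 2) - 1)
              * (\<Prod>\<rho>=1..p - 1. W \<rho> ^ (p ^ (m - 2)))
          + of_nat ((p - 1) div 2 * (p ^ (m - 1) + p ^ ((m - 1) div 2)))
              * W 0 ^ (p ^ (m - 2) - 1 + (p - 1) * p ^ ((m - 3) div 2))
              * (\<Prod>\<rho>=1..p - 1. W \<rho> ^ (p ^ (m - 2) - p ^ ((m - 3) div 2)))
          + of_nat ((p - 1) div 2 * (p ^ (m - 1) - p ^ ((m - 1) div 2)))
              * W 0 ^ (p ^ (m - 2) - 1 - (p - 1) * p ^ ((m - 3) div 2))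
              * (\<Prod>\<rho>=1..p - 1. W \<rho> ^ (p ^ (m - 2) + p ^ ((m - 3) div 2))))
   \<and> (even m \<and> m \<ge> 2 \<longrightarrow>
        int n = int p ^ (m - 1) - 1 - \<epsilon> * (int p - 1) * int p ^ ((m - 2) div 2) \<and>
        (0 < n \<longrightarrow>
          linear_code n m C \<and>
          CWE C =
            W 0 ^ nat (int p ^ (m - 1) - 1 - \<epsilon> * (int p - 1) * int p ^ ((m - 2) div 2))
            + of_int (int p ^ (m - 1) - 1 - \<epsilon> * (int p - 1) * int p ^ ((m - 2) div 2))
                * W 0 ^ nat (int p ^ (m - 2) - 1 - \<epsilon> * (int p - 1) * int p ^ ((m - 2) div 2))
                * (\<Prod>\<rho>=1..p - 1. W \<rho> ^ (p ^ (m - 2)))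
            + of_int ((int p - 1) * (int p ^ (m - 1) + \<epsilon> * int p ^ ((m - 2) div 2)))
                * W 0 ^ (p ^ (m - 2) - 1)
                * (\<Prod>\<rho>=1..p - 1.
                    W \<rho> ^ nat (int p ^ (m - 2) - \<epsilon> * int p ^ ((m - 2) div 2)))))"
proof -
  interpret trace_code "embed :: 'p mod_ring \<Rightarrow> 'a" m ds
    by unfold_locales (use assms in simp_all)
  have C: "C = range codeword"
    unfolding assms(8) codeword_def assms(7) by (simp add: full_SetCompr_eq)
  have "ds \<noteq> []" if "0 < n"
    using that assms(7) by simp
  then show ?thesis
    unfolding C assms(1,7,9) using odd_case even_case linear_code_range by blast
qed

end
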